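(* Let $\rho(u)=n\lambda_*^2\rho_H((\sqrt n\lambda_* )^{-1}u)$ where $\rho_H(u)=\int_0^{|u|}\min(t,1)dt$ is the Huber loss, and let $g(b)=\lambda\|b\|_1$ be the penalty, for $\lambda_*,\lambda>0$. Let $$\hat\beta=\hat\beta(y,X)\in\operatorname{argmin}_{b\in\mathbb R^p}\Big(\frac1n\sum_{i=1}^n\rho(y_i-x_i^\top b)+g(b)\Big).$$ For almost every $(y,X)\in\mathbb R^n\times\mathbb R^{n\times p}$, the functions $y\mapsto\hat I$, $y\mapsto\hat S$ and $y\mapsto\operatorname{diag}(\psi')$ are constant in a neighborhood of $y$, and $$\hat Q:=\operatorname{diag}(\psi')\,(\partial/\partial y)X\hat\beta$$ is the orthogonal projection onto the column span of $\operatorname{diag}(\psi')X_{\hat S}$. Furthermore $(\partial/\partial y)\hat\psi=\operatorname{diag}(\psi')-\hat Q$, and for almost every $(y,X)$ $$\hat{\mathsf{df}}=\operatorname{Tr}[\operatorname{diag}(\psi')(\partial/\partial y)X\hat\beta]=|\hat S|,\qquad\operatorname{Tr}[(\partial/\partial y)\hat\psi]=|\hat I|-|\hat S|\ge0.$$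
   Context: $x_1,\dots,x_n$ are the rows of $X\in\mathbb R^{n\times p}$. $\psi=\rho'$ acts componentwise, $\hat\psi=\psi(y-X\hat\beta)\in\mathbb R^n$, and $\operatorname{diag}(\psi')\in\mathbb R^{n\times n}$ is the diagonal matrix with diagonal entries $\psi'(y_i-x_i^\top\hat\beta)$. $\hat I=\{i\in[n]:\psi'(y_i-x_i^\top\hat\beta)>0\}$ (inliers), $\hat S=\{j\in[p]:\hat\beta_j\ne0\}$, $X_{\hat S}$ is the submatrix of $X$ made of columns indexed in $\hat S$, and $\hat{\mathsf{df}}=\operatorname{Tr}[(\partial/\partial y)X\hat\beta]$. Derivatives with respect to $y$ are taken with $X$ fixed. *)

theory Defs
  imports "HOL-Analysis.Analysis"
begin

definition huber :: "real \<Rightarrow> real" where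
  "huber u = integral {0..\<bar>u\<bar>} (\<lambda>t. min t 1)"

text \<open>In the definitions below \<open>ls\<close> is the parameter \<open>\<lambda>\<^sub>*\<close> of the loss, \<open>lam\<close> is the
  parameter \<open>\<lambda>\<close> of the penalty, and the sample size is \<open>n = CARD('n)\<close>.\<close>

definition scaled_huber :: "nat \<Rightarrow> real \<Rightarrow> real \<Rightarrow> real" where
  "scaled_huber n ls u = real n * ls\<^sup>2 * huber (inverse (sqrt (real n) * ls) * u)"

text \<open>\<open>\<psi>\<close> has kinks at \<open>\<plusminus> sqrt n * ls\<close>; it is not differentiable there, so the
  value of \<open>\<psi>' = deriv \<psi>\<close> at these two points is unspecified.\<close>

definition psi :: "nat \<Rightarrow> real \<Rightarrow> real \<Rightarrow> real" where
  "psi n ls = deriv (scaled_huber n ls)"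

definition psi' :: "nat \<Rightarrow> real \<Rightarrow> real \<Rightarrow> real" where
  "psi' n ls = deriv (psi n ls)"

definition l1_norm :: "real^'p \<Rightarrow> real" where
  "l1_norm b = (\<Sum>j\<in>UNIV. \<bar>b $ j\<bar>)"

definition resid :: "real^'n \<Rightarrow> real^'p^'n \<Rightarrow> real^'p \<Rightarrow> 'n \<Rightarrow> real" where
  "resid y X b i = y $ i - row i X \<bullet> b"

definition huber_lasso_objective ::
    "real \<Rightarrow> real \<Rightarrow> real^'n \<Rightarrow> real^'p^'n \<Rightarrow> real^'p \<Rightarrow> real" where
  "huber_lasso_objective ls lam y X b =
     1 / real CARD('n) * (\<Sum>i\<in>UNIV. scaled_huber CARD('n) ls (resid y X b i)) + lam * l1_norm b"

definition psi_vec :: "real \<Rightarrow> real^'n \<Rightarrow> real^'p^'n \<Rightarrow> real^'p \<Rightarrow> real^'n" where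
  "psi_vec ls y X b = (\<chi> i. psi CARD('n) ls (resid y X b i))"

definition diag_psi' :: "real \<Rightarrow> real^'n \<Rightarrow> real^'p^'n \<Rightarrow> real^'p \<Rightarrow> real^'n^'n" where
  "diag_psi' ls y X b = (\<chi> i k. if i = k then psi' CARD('n) ls (resid y X b i) else 0)"

definition inliers :: "real \<Rightarrow> real^'n \<Rightarrow> real^'p^'n \<Rightarrow> real^'p \<Rightarrow> 'n set" where
  "inliers ls y X b = {i. psi' CARD('n) ls (resid y X b i) > 0}"

definition coord_support :: "real^'p \<Rightarrow> 'p set" where
  "coord_support b = {j. b $ j \<noteq> 0}"

text \<open>The submatrix \<open>X\<^sub>S\<close> has a number of columns that depends on \<open>S\<close>, so it is not a matrix
  over a fixed index type. The columns of \<open>D X\<^sub>S\<close> are \<open>D\<close> applied to the columns of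
  \<open>X\<close> indexed in \<open>S\<close>.\<close>

definition col_span_on :: "real^'n^'m \<Rightarrow> real^'p^'n \<Rightarrow> 'p set \<Rightarrow> (real^'m) set" where
  "col_span_on D X S = span ((\<lambda>j. D *v column j X) ` S)"

definition is_orthogonal_projection :: "real^'n^'n \<Rightarrow> (real^'n) set \<Rightarrow> bool" where
  "is_orthogonal_projection Q V \<longleftrightarrow>
     (\<forall>v. Q *v v \<in> V \<and> (\<forall>w\<in>V. orthogonal (v - Q *v v) w))"

end

theory Submission
  imports Defs
begin

text \<open>The vector \<open>\<psi>(y - X \<beta>)\<close> at a minimizer \<open>\<beta>\<close> is the projection of \<open>y\<close> onto the polytope
  of all \<open>u\<close> with \<open>\<bar>X\<^sub>j \<bullet> u\<bar> \<le> n \<lambda>\<close> for every column \<open>X\<^sub>j\<close> and \<open>\<bar>u\<^sub>i\<bar> \<le> sqrt n \<lambda>\<^sub>*\<close>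
  for every \<open>i\<close>. The multiplier of a column constraint is \<open>\<beta>\<^sub>j\<close>, the one of a box constraint is
  \<open>r\<^sub>i - \<psi>(r\<^sub>i)\<close> with \<open>r\<close> the residual. For almost every \<open>(y, X)\<close> the normals of the active
  constraints are linearly independent and their multipliers do not vanish. The active set is then
  locally constant in \<open>y\<close>, and the multipliers, hence \<open>\<beta>\<close>, are affine in \<open>y\<close> with linear parts
  given by the dual basis \<open>d\<close> of the active normals. This determines all derivatives and gives
  the degrees of freedom as \<open>\<Sum>\<^sub>j d\<^sub>j \<bullet> X\<^sub>j\<close>, a sum over the support.

  Both exceptional sets are Borel, as projections of closed sets. They are null because each meets
  every orbit of a suitable flow at most once: multiplication of one column by \<open>exp s\<close> for dependent
  active normals, translation of \<open>y\<close> along an active normal for vanishing multipliers.\<close>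

section \<open>The scaled Huber loss\<close>

text \<open>The squared positive part is differentiable across its kink, because the difference
  quotient at 0 is bounded by \<open>\<bar>h\<bar>\<close>. The Huber loss is assembled from such
  pieces, so its derivative then needs no case distinction at the points where it turns
  linear.\<close>

lemma has_real_derivative_max_0_sq:
  fixes x :: real
  shows "((\<lambda>x. (max x 0)\<^sup>2 / 2) has_real_derivative max x 0) (at x)"
proof -
  consider "x > 0" | "x < 0" | "x = 0" by linarith
  then show ?thesis
  proof cases
    case 1
    have "((\<lambda>x. x\<^sup>2 / 2) has_real_derivative x) (at x)"
      by (auto intro!: derivative_eq_intros)
    then have "((\<lambda>x. (max x 0)\<^sup>2 / 2) has_real_derivative x) (at x)"
      by (rule has_field_derivative_transform_within_open[of _ _ _ "{0<..}"]) (use 1 in auto)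
    with 1 show ?thesis by simp
  next
    case 2
    have "((\<lambda>x. 0) has_real_derivative 0) (at x)"
      by (auto intro!: derivative_eq_intros)
    then have "((\<lambda>x. (max x 0)\<^sup>2 / 2) has_real_derivative 0) (at x)"
      by (rule has_field_derivative_transform_within_open[of _ _ _ "{..<0}"]) (use 2 in auto)
    with 2 show ?thesis by simp
  next
    case 3
    have "((\<lambda>h. max h 0 * (max h 0 / h) / 2) \<longlongrightarrow> 0) (at (0::real))"
    proof (rule Lim_null_comparison)
      show "\<forall>\<^sub>F h in at (0::real). norm (max h 0 * (max h 0 / h) / 2) \<le> \<bar>h\<bar>"
        by (auto simp: eventually_at_filter max_def divide_simps power2_eq_square)
      show "((\<lambda>h. \<bar>h\<bar>) \<longlongrightarrow> 0) (at (0::real))"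
        by (simp add: tendsto_rabs_zero_iff)
    qed
    with 3 show ?thesis by (simp add: DERIV_def power2_eq_square mult.commute)
  qed
qed

lemma has_real_derivative_max_0_sq_chain:
  fixes f :: "real \<Rightarrow> real"
  assumes "(f has_real_derivative D) (at x)"
  shows "((\<lambda>x. (max (f x) 0)\<^sup>2 / 2) has_real_derivative max (f x) 0 * D) (at x)"
  using assms by (rule DERIV_chain2[OF has_real_derivative_max_0_sq])

lemma has_real_derivative_half_sq: "((\<lambda>x. x\<^sup>2 / 2) has_real_derivative x) (at (x::real))"
  by (auto intro!: derivative_eq_intros)

text \<open>A parabola with its excess beyond each of the points 1 and -1 subtracted. On the range
  of integration \<open>F\<close> is an antiderivative of the integrand, and at most one of the two
  excess terms is nonzero for a given \<open>u\<close>.\<close>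

lemma huber_eq: "huber u = u\<^sup>2 / 2 - (max (u - 1) 0)\<^sup>2 / 2 - (max (- u - 1) 0)\<^sup>2 / 2"
proof -
  define F :: "real \<Rightarrow> real" where "F = (\<lambda>t. t\<^sup>2 / 2 - (max (t - 1) 0)\<^sup>2 / 2)"
  have "(F has_real_derivative t - max (t - 1) 0 * 1) (at t)" for t
    unfolding F_def
    by (intro DERIV_diff has_real_derivative_half_sq has_real_derivative_max_0_sq_chain)
      (auto intro!: derivative_eq_intros)
  moreover have "t - max (t - 1) 0 * 1 = min t 1" for t :: real by (simp add: max_def min_def)
  ultimately have "(F has_real_derivative min t 1) (at t within {0..\<bar>u\<bar>})" for t
    by (metis has_field_derivative_at_within)
  then have "((\<lambda>t. min t 1) has_integral (F \<bar>u\<bar> - F 0)) {0..\<bar>u\<bar>}"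
    by (intro fundamental_theorem_of_calculus)
      (auto simp: has_real_derivative_iff_has_vector_derivative)
  then have "huber u = F \<bar>u\<bar> - F 0"
    unfolding huber_def by (rule integral_unique)
  then show ?thesis by (auto simp: F_def abs_if max_def)
qed

lemma has_real_derivative_huber: "(huber has_real_derivative max (- 1) (min u 1)) (at u)"
proof -
  have "((\<lambda>u. u\<^sup>2 / 2 - (max (u - 1) 0)\<^sup>2 / 2 - (max (- u - 1) 0)\<^sup>2 / 2)
      has_real_derivative u - max (u - 1) 0 * 1 - max (- u - 1) 0 * - 1) (at u)"
    by (intro DERIV_diff has_real_derivative_half_sq has_real_derivative_max_0_sq_chain)
      (auto intro!: derivative_eq_intros)
  moreover have "u - max (u - 1) 0 * 1 - max (- u - 1) 0 * - 1 = max (- 1) (min u 1)"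
    by (simp add: max_def min_def)
  ultimately show ?thesis by (simp add: huber_eq[abs_def])
qed

lemma has_real_derivative_scaled_huber:
  assumes "0 < n" "0 < ls"
  shows "(scaled_huber n ls has_real_derivative
    max (- (sqrt n * ls)) (min u (sqrt n * ls))) (at u)"
proof -
  define c where "c = sqrt n * ls"
  have c: "c > 0" "n * ls\<^sup>2 = c\<^sup>2"
    using assms by (auto simp: c_def power_mult_distrib)
  have "((\<lambda>u. c\<^sup>2 * huber (inverse c * u)) has_real_derivative
      c\<^sup>2 * (max (- 1) (min (inverse c * u) 1) * inverse c)) (at u)"
    by (auto intro!: derivative_eq_intros DERIV_chain2[OF has_real_derivative_huber])
  moreover have "c\<^sup>2 * (max (- 1) (min (inverse c * u) 1) * inverse c) = max (- c) (min u c)"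
    using c(1) by (auto simp: max_def min_def field_simps power2_eq_square)
  moreover have "scaled_huber n ls = (\<lambda>u. c\<^sup>2 * huber (inverse c * u))"
    using c(2) by (auto simp: scaled_huber_def c_def)
  ultimately show ?thesis by (simp add: c_def)
qed

text \<open>The score is the projection of the real line onto an interval. Applied to all residuals,
  it is the source of the box constraints of the polytope.\<close>

lemma psi_eq:
  assumes "0 < n" "0 < ls"
  shows "psi n ls = (\<lambda>u. max (- (sqrt n * ls)) (min u (sqrt n * ls)))"
  unfolding psi_def using has_real_derivative_scaled_huber[OF assms]
  by (auto intro!: DERIV_imp_deriv)

lemma has_real_derivative_psi:
  assumes "0 < n" "0 < ls" "\<bar>u\<bar> \<noteq> sqrt n * ls"
  shows "(psi n ls has_real_derivative of_bool (\<bar>u\<bar> < sqrt n * ls)) (at u)"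
proof -
  define c where "c = sqrt n * ls"
  have c: "c > 0" using assms by (simp add: c_def)
  have psi: "psi n ls u = max (- c) (min u c)" for u
    using psi_eq[OF assms(1,2)] by (simp add: c_def)
  consider "\<bar>u\<bar> < c" | "u > c" | "u < - c" using assms(3) unfolding c_def by linarith
  then have "(psi n ls has_real_derivative of_bool (\<bar>u\<bar> < c)) (at u)"
  proof cases
    case 1
    have "((\<lambda>u. u) has_real_derivative 1) (at u)" by simp
    then have "(psi n ls has_real_derivative 1) (at u)"
      by (rule has_field_derivative_transform_within_open[of _ _ _ "{-c<..<c}"])
        (use 1 psi in auto)
    with 1 show ?thesis by simp
  next
    case 2
    have "((\<lambda>u. c) has_real_derivative 0) (at u)" by simp
    then have "(psi n ls has_real_derivative 0) (at u)"
      by (rule has_field_derivative_transform_within_open[of _ _ _ "{c<..}"])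
        (use 2 c psi in auto)
    with 2 c show ?thesis by simp
  next
    case 3
    have "((\<lambda>u. - c) has_real_derivative 0) (at u)" by simp
    then have "(psi n ls has_real_derivative 0) (at u)"
      by (rule has_field_derivative_transform_within_open[of _ _ _ "{..<-c}"])
        (use 3 c psi in auto)
    with 3 c show ?thesis by simp
  qed
  then show ?thesis by (simp add: c_def)
qed

text \<open>The kinks are excluded because the value of \<open>deriv\<close> is unspecified there;
  at nondegenerate data no residual sits on a kink.\<close>

lemma psi'_eq:
  assumes "0 < n" "0 < ls" "\<bar>u\<bar> \<noteq> sqrt n * ls"
  shows "psi' n ls u = of_bool (\<bar>u\<bar> < sqrt n * ls)"
  unfolding psi'_def by (rule DERIV_imp_deriv[OF has_real_derivative_psi[OF assms]])

section \<open>Projections onto polytopes\<close>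

lemma span_image_imp_combination:
  fixes v :: "'i \<Rightarrow> 'a::real_vector"
  assumes "finite T" "x \<in> span (v ` T)"
  shows "\<exists>a. x = (\<Sum>l\<in>T. a l *\<^sub>R v l)"
proof -
  \<comment> \<open>The combinations form a subspace that contains the generators. Coefficients
    belong to indices and not to vectors, since different indices may carry the same vector.\<close>
  have "span (v ` T) \<subseteq> range (\<lambda>a. \<Sum>l\<in>T. a l *\<^sub>R v l)"
  proof (rule span_minimal)
    show "v ` T \<subseteq> range (\<lambda>a. \<Sum>l\<in>T. a l *\<^sub>R v l)"
    proof clarify
      fix k assume "k \<in> T"
      then have "v k = (\<Sum>l\<in>T. of_bool (l = k) *\<^sub>R v l)"
        using assms(1) by (simp add: of_bool_def if_distrib[of "\<lambda>c. c *\<^sub>R _"] sum.delta cong: if_cong)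
      then show "v k \<in> range (\<lambda>a. \<Sum>l\<in>T. a l *\<^sub>R v l)"
        by (rule image_eqI[of _ _ "\<lambda>l. of_bool (l = k)"]) simp
    qed
    show "subspace (range (\<lambda>a. \<Sum>l\<in>T. a l *\<^sub>R v l))"
    proof (rule subspaceI)
      show "0 \<in> range (\<lambda>a. \<Sum>l\<in>T. a l *\<^sub>R v l)" by (rule image_eqI[of _ _ "\<lambda>_. 0"]) auto
    next
      fix x y assume "x \<in> range (\<lambda>a. \<Sum>l\<in>T. a l *\<^sub>R v l)" "y \<in> range (\<lambda>a. \<Sum>l\<in>T. a l *\<^sub>R v l)"
      then obtain a b where "x = (\<Sum>l\<in>T. a l *\<^sub>R v l)" "y = (\<Sum>l\<in>T. b l *\<^sub>R v l)" by auto
      then have "x + y = (\<Sum>l\<in>T. (a l + b l) *\<^sub>R v l)"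
        by (simp add: scaleR_left_distrib sum.distrib)
      then show "x + y \<in> range (\<lambda>a. \<Sum>l\<in>T. a l *\<^sub>R v l)"
        by (rule image_eqI[of _ _ "\<lambda>l. a l + b l"]) simp
    next
      fix r x assume "x \<in> range (\<lambda>a. \<Sum>l\<in>T. a l *\<^sub>R v l)"
      then obtain a where "x = (\<Sum>l\<in>T. a l *\<^sub>R v l)" by auto
      then have "r *\<^sub>R x = (\<Sum>l\<in>T. (r * a l) *\<^sub>R v l)"
        by (simp add: scaleR_sum_right)
      then show "r *\<^sub>R x \<in> range (\<lambda>a. \<Sum>l\<in>T. a l *\<^sub>R v l)"
        by (rule image_eqI[of _ _ "\<lambda>l. r * a l"]) simp
    qed
  qed
  with assms(2) show ?thesis by blast
qed

text \<open>Each \<open>d l\<close> is the component of \<open>v l\<close> orthogonal to the span of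
  the other vectors, rescaled. Independence makes that component nonzero, and it stays inside the
  span of the whole family.\<close>

lemma dual_family_exists:
  fixes v :: "'i \<Rightarrow> 'a::euclidean_space"
  assumes "finite T" and indep: "\<And>k. k \<in> T \<Longrightarrow> v k \<notin> span (v ` (T - {k}))"
  obtains d where "\<And>l. l \<in> T \<Longrightarrow> d l \<in> span (v ` T)"
    and "\<And>l m. l \<in> T \<Longrightarrow> m \<in> T \<Longrightarrow> d l \<bullet> v m = of_bool (l = m)"
proof -
  have "\<exists>d. d \<in> span (v ` T) \<and> (\<forall>m\<in>T. d \<bullet> v m = of_bool (l = m))" if "l \<in> T" for l
  proof -
    obtain s w where s: "s \<in> span (v ` (T - {l}))"
      and w: "\<And>x. x \<in> span (v ` (T - {l})) \<Longrightarrow> orthogonal w x" and eq: "v l = s + w"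
      using orthogonal_subspace_decomp_exists[of "v ` (T - {l})" "v l"] by metis
    have "w \<noteq> 0" using s eq indep[OF that] by auto
    have "w = v l - s" using eq by simp
    moreover have "s \<in> span (v ` T)" using s span_mono[of "v ` (T - {l})" "v ` T"] by blast
    ultimately have wT: "w \<in> span (v ` T)" using that by (simp add: span_diff span_base)
    have 1: "w \<bullet> v l = w \<bullet> w" using w[OF s] eq by (simp add: orthogonal_def inner_add_right)
    have 2: "w \<bullet> v m = 0" if "m \<in> T" "l \<noteq> m" for m
      using w[of "v m"] that by (auto simp: orthogonal_def span_base)
    show ?thesis
      by (rule exI[of _ "inverse (w \<bullet> w) *\<^sub>R w"])
        (use \<open>w \<noteq> 0\<close> 1 2 wT in \<open>auto simp: span_scale of_bool_def\<close>)
  qed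
  then obtain d where "\<forall>l\<in>T. d l \<in> span (v ` T) \<and> (\<forall>m\<in>T. d l \<bullet> v m = of_bool (l = m))"
    by metis
  then show ?thesis using that[of d] by blast
qed

text \<open>Pairing with \<open>d l\<close> separates \<open>v l\<close> from the span of the
  others, so the family is injective and independent. This later bounds the number of active
  constraints by the sample size.\<close>

lemma card_le_DIM_if_dual_family:
  fixes v :: "'i \<Rightarrow> 'a::euclidean_space"
  assumes "finite T" and dual: "\<And>l m. l \<in> T \<Longrightarrow> m \<in> T \<Longrightarrow> d l \<bullet> v m = of_bool (l = m)"
  shows "card T \<le> DIM('a)"
proof -
  have inj: "inj_on v T"
    using dual by (intro inj_onI) (metis of_bool_eq_iff)
  have "independent (v ` T)"
    unfolding dependent_def
  proof clarify
    fix l assume l: "l \<in> T" "v l \<in> span (v ` T - {v l})"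
    have "d l \<bullet> x = 0" if "x \<in> span (v ` T - {v l})" for x
      using that by (induction rule: span_induct)
        (auto simp: subspace_def inner_add_right dual l(1))
    from this[OF l(2)] dual[OF l(1) l(1)] show False by simp
  qed
  then have "card (v ` T) \<le> DIM('a)" by (rule independent_bound[THEN conjunct2])
  with inj show ?thesis by (simp add: card_image)
qed

text \<open>\<open>u\<close> is the projection of \<open>z\<close> onto the polytope \<open>{w. \<forall>l. \<bar>v l \<bullet> w\<bar> \<le> c l}\<close>,
  with multipliers \<open>a\<close>.\<close>

definition kkt :: "('i::finite \<Rightarrow> 'a::euclidean_space) \<Rightarrow> ('i \<Rightarrow> real) \<Rightarrow> 'a \<Rightarrow> 'a \<Rightarrow> ('i \<Rightarrow> real) \<Rightarrow> bool"
  where "kkt v c z u a \<longleftrightarrow> z - u = (\<Sum>l\<in>UNIV. a l *\<^sub>R v l) \<and>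
    (\<forall>l. \<bar>v l \<bullet> u\<bar> \<le> c l) \<and> (\<forall>l. a l \<noteq> 0 \<longrightarrow> v l \<bullet> u = c l * sgn (a l))"

text \<open>The obtuse angle criterion for a projection onto a convex set. A nonzero multiplier
  points to the side of its slab on which \<open>u\<close> is tight, so moving from \<open>u\<close>
  to a feasible \<open>w\<close> cannot increase that constraint in the direction of the
  multiplier.\<close>

lemma kkt_variational:
  assumes "kkt v c z u a" "\<And>l. \<bar>v l \<bullet> w\<bar> \<le> c l"
  shows "(z - u) \<bullet> (w - u) \<le> 0"
proof -
  have "a l * (v l \<bullet> (w - u)) \<le> 0" for l
  proof (cases "a l = 0")
    case False
    then have "v l \<bullet> u = c l * sgn (a l)" using assms(1) by (simp add: kkt_def)
    with assms(2)[of l] False show ?thesis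
      by (auto simp: inner_diff_right sgn_if split: if_splits intro: mult_nonneg_nonpos mult_nonpos_nonneg)
  qed simp
  then show ?thesis
    using assms(1) by (simp add: kkt_def inner_sum_left sum_nonpos)
qed

lemma kkt_inactive:
  assumes "kkt v c z u a" "\<bar>v l \<bullet> u\<bar> < c l"
  shows "a l = 0"
proof (rule ccontr)
  assume "a l \<noteq> 0"
  with assms show False by (auto simp: kkt_def sgn_if split: if_splits)
qed

text \<open>Projections are nonexpansive: each of the two points is tested in the variational
  inequality of the other, the inequalities are added, and Cauchy-Schwarz finishes.\<close>

lemma kkt_lipschitz:
  assumes "kkt v c z u a" "kkt v c z' u' a'"
  shows "norm (u - u') \<le> norm (z - z')"
proof -
  have "\<bar>v l \<bullet> u\<bar> \<le> c l" "\<bar>v l \<bullet> u'\<bar> \<le> c l" for l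
    using assms by (auto simp: kkt_def)
  then have "(z - u) \<bullet> (u' - u) \<le> 0" "(z' - u') \<bullet> (u - u') \<le> 0"
    using kkt_variational[OF assms(1)] kkt_variational[OF assms(2)] by blast+
  then have "(u - u') \<bullet> (u - u') \<le> (z - z') \<bullet> (u - u')"
    by (simp add: algebra_simps inner_commute)
  also have "\<dots> \<le> norm (z - z') * norm (u - u')" by (rule norm_cauchy_schwarz)
  finally have "norm (u - u') * norm (u - u') \<le> norm (z - z') * norm (u - u')"
    unfolding dot_square_norm power2_eq_square .
  then show ?thesis
    by (cases "u = u'") (auto dest: mult_right_le_imp_le)
qed

text \<open>Since \<open>u\<close> moves continuously with \<open>z\<close>, slack constraints stay
  slack, and nonzero multipliers keep their signs. The active constraints therefore keep their
  values, so \<open>u - u0\<close> is orthogonal to the active normals and drops out of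
  \<open>d l \<bullet> (z - u)\<close>. Quantifying over all \<open>u\<close> and \<open>a\<close>
  makes the result independent of how a minimizer is selected.\<close>

lemma kkt_locally_affine:
  fixes v :: "'i::finite \<Rightarrow> 'a::euclidean_space"
  assumes kkt0: "kkt v c y u0 a0" and T: "T = {l. \<bar>v l \<bullet> u0\<bar> = c l}"
    and nz: "\<And>l. l \<in> T \<Longrightarrow> a0 l \<noteq> 0"
    and d_span: "\<And>l. l \<in> T \<Longrightarrow> d l \<in> span (v ` T)"
    and dual: "\<And>l m. l \<in> T \<Longrightarrow> m \<in> T \<Longrightarrow> d l \<bullet> v m = of_bool (l = m)"
  shows "\<forall>\<^sub>F z in nhds y. \<forall>u a. kkt v c z u a \<longrightarrow>
    (\<forall>l\<in>T. a l \<noteq> 0 \<and> a l = a0 l + d l \<bullet> (z - y) \<and> v l \<bullet> u = v l \<bullet> u0) \<and>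
    (\<forall>l. l \<notin> T \<longrightarrow> a l = 0 \<and> \<bar>v l \<bullet> u\<bar> < c l)"
proof -
  \<comment> \<open>Once the inactive multipliers vanish, pairing with the dual vector reads off a
    single coefficient.\<close>
  have coeff: "a l = d l \<bullet> (z - u)" if "kkt v c z u a" "\<And>m. m \<notin> T \<Longrightarrow> a m = 0" "l \<in> T" for z u a l
  proof -
    have "z - u = (\<Sum>m\<in>T. a m *\<^sub>R v m)"
      using that(1,2) by (auto simp: kkt_def intro!: sum.mono_neutral_right)
    then have "d l \<bullet> (z - u) = (\<Sum>m\<in>T. a m * of_bool (l = m))"
      using that(3) by (simp add: inner_sum_right dual cong: sum.cong)
    also have "\<dots> = a l" using that(3) by (simp add: of_bool_def if_distrib[of "(*) _"] cong: if_cong)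
    finally show ?thesis by simp
  qed
  have inact0: "\<bar>v m \<bullet> u0\<bar> < c m" if "m \<notin> T" for m
  proof -
    have "\<bar>v m \<bullet> u0\<bar> \<le> c m" using kkt0 by (simp add: kkt_def)
    moreover have "\<bar>v m \<bullet> u0\<bar> \<noteq> c m" using that by (simp add: T)
    ultimately show ?thesis by simp
  qed
  have u0: "a0 m = 0" if "m \<notin> T" for m
    by (rule kkt_inactive[OF kkt0 inact0[OF that]])
  have "\<forall>\<^sub>F u in nhds u0. \<bar>v l \<bullet> u\<bar> < c l" if "l \<notin> T" for l
  proof -
    have "((\<lambda>u. \<bar>v l \<bullet> u\<bar>) \<longlongrightarrow> \<bar>v l \<bullet> u0\<bar>) (nhds u0)"
      by (intro tendsto_intros filterlim_ident)
    then show ?thesis by (rule order_tendstoD) (rule inact0[OF that])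
  qed
  then have "\<forall>\<^sub>F u in nhds u0. \<forall>l\<in>- T. \<bar>v l \<bullet> u\<bar> < c l"
    by (intro eventually_ball_finite) auto
  then obtain e where e: "e > 0" "\<And>u l. dist u u0 < e \<Longrightarrow> l \<notin> T \<Longrightarrow> \<bar>v l \<bullet> u\<bar> < c l"
    unfolding eventually_nhds_metric by auto
  have "\<forall>\<^sub>F w in nhds (y - u0). sgn (d l \<bullet> w) = sgn (a0 l)" if "l \<in> T" for l
  proof -
    have lim: "((\<lambda>w. d l \<bullet> w) \<longlongrightarrow> d l \<bullet> (y - u0)) (nhds (y - u0))"
      by (intro tendsto_intros filterlim_ident)
    have eq: "d l \<bullet> (y - u0) = a0 l" using coeff[OF kkt0 u0 that] by simp
    show ?thesis
    proof (cases "a0 l > 0")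
      case True
      have "\<forall>\<^sub>F w in nhds (y - u0). 0 < d l \<bullet> w"
        by (rule order_tendstoD(1)[OF lim]) (use eq True in simp)
      then show ?thesis by eventually_elim (use True in simp)
    next
      case False
      then have neg: "a0 l < 0" using nz[OF that] by simp
      have "\<forall>\<^sub>F w in nhds (y - u0). d l \<bullet> w < 0"
        by (rule order_tendstoD(2)[OF lim]) (use eq neg in simp)
      then show ?thesis by eventually_elim (use neg in simp)
    qed
  qed
  then have "\<forall>\<^sub>F w in nhds (y - u0). \<forall>l\<in>T. sgn (d l \<bullet> w) = sgn (a0 l)"
    by (intro eventually_ball_finite) auto
  then obtain e' where e': "e' > 0"
    "\<And>w l. dist w (y - u0) < e' \<Longrightarrow> l \<in> T \<Longrightarrow> sgn (d l \<bullet> w) = sgn (a0 l)"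
    unfolding eventually_nhds_metric by auto
  have "(\<forall>l\<in>T. a l \<noteq> 0 \<and> a l = a0 l + d l \<bullet> (z - y) \<and> v l \<bullet> u = v l \<bullet> u0) \<and>
      (\<forall>l. l \<notin> T \<longrightarrow> a l = 0 \<and> \<bar>v l \<bullet> u\<bar> < c l)"
    \<comment> \<open>By nonexpansiveness \<open>z - u\<close> moves at most twice as far as
      \<open>z\<close>, whence \<open>e' / 2\<close>; the bound \<open>e\<close> keeps
      \<open>u\<close> where the inactive constraints are slack.\<close>
    if z: "dist z y < min e (e' / 2)" and k: "kkt v c z u a" for z u a
  proof
    have lip: "dist u u0 \<le> dist z y" using kkt_lipschitz[OF k kkt0] by (simp add: dist_norm)
    have inact: "\<bar>v l \<bullet> u\<bar> < c l \<and> a l = 0" if "l \<notin> T" for l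
    proof -
      have "\<bar>v l \<bullet> u\<bar> < c l" using e(2)[OF _ that] lip z by simp
      moreover from this have "a l = 0"
        by (rule kkt_inactive[OF k])
      ultimately show ?thesis by simp
    qed
    have "dist (z - u) (y - u0) \<le> dist z y + dist u u0"
      using norm_triangle_ineq4[of "z - y" "u - u0"] by (simp add: dist_norm algebra_simps)
    then have "dist (z - u) (y - u0) < e'" using lip z by simp
    note sg = e'(2)[OF this]
    have act: "sgn (a l) = sgn (a0 l)" "v l \<bullet> u = v l \<bullet> u0" "a l \<noteq> 0" if "l \<in> T" for l
    proof -
      show 1: "sgn (a l) = sgn (a0 l)" using coeff[OF k _ that] inact sg[OF that] by simp
      then show 2: "a l \<noteq> 0" using nz[OF that] by (metis sgn_0_0)
      show "v l \<bullet> u = v l \<bullet> u0" using k kkt0 1 2 nz[OF that] by (simp add: kkt_def)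
    qed
    have const: "x \<bullet> u = x \<bullet> u0" if "x \<in> span (v ` T)" for x
      using that by (induction rule: span_induct) (auto simp: subspace_def inner_add_left act)
    show "\<forall>l. l \<notin> T \<longrightarrow> a l = 0 \<and> \<bar>v l \<bullet> u\<bar> < c l" using inact by simp
    show "\<forall>l\<in>T. a l \<noteq> 0 \<and> a l = a0 l + d l \<bullet> (z - y) \<and> v l \<bullet> u = v l \<bullet> u0"
    proof
      fix l assume l: "l \<in> T"
      have "a l = d l \<bullet> (z - u)" using coeff[OF k _ l] inact by simp
      moreover have "a0 l = d l \<bullet> (y - u0)" using coeff[OF kkt0 u0 l] by simp
      ultimately have "a l = a0 l + d l \<bullet> (z - y)"
        using const[OF d_span[OF l]] by (simp add: inner_diff_right)
      then show "a l \<noteq> 0 \<and> a l = a0 l + d l \<bullet> (z - y) \<and> v l \<bullet> u = v l \<bullet> u0"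
        using act(2,3)[OF l] by blast
    qed
  qed
  moreover have "min e (e' / 2) > 0" using e(1) e'(1) by simp
  ultimately show ?thesis
    unfolding eventually_nhds_metric by blast
qed

section \<open>Exceptional sets\<close>

text \<open>A projection of a closed set need not be closed, but a closed set is a countable union
  of compact sets, whose projections are compact.\<close>

lemma borel_fst_image_closed:
  fixes C :: "('a::euclidean_space \<times> 'b::euclidean_space) set"
  assumes "closed C"
  shows "fst ` C \<in> sets borel"
proof -
  have "fst ` C = (\<Union>n::nat. fst ` (C \<inter> cball 0 (real n)))"
  proof (intro equalityI subsetI)
    fix x assume "x \<in> fst ` C"
    then obtain p where p: "p \<in> C" "x = fst p" by auto
    obtain n where "norm p \<le> real n" using real_arch_simple by blast
    with p have "p \<in> C \<inter> cball 0 (real n)" by simp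
    then show "x \<in> (\<Union>n::nat. fst ` (C \<inter> cball 0 (real n)))" using p(2) by blast
  qed auto
  moreover have "fst ` (C \<inter> cball 0 (real n)) \<in> sets borel" for n
    using assms by (intro borel_compact compact_continuous_image continuous_on_fst
        continuous_on_id closed_Int_compact) auto
  ultimately show ?thesis
    by (simp only:) (rule sets.countable_UN, auto)
qed

text \<open>A Fubini argument on pairs of a point and a time. For a fixed point the bad times form
  at most a singleton; hence for almost every time the bad points form a null set. At one such time
  \<open>s\<close>, the map \<open>\<phi> s\<close> carries this null set onto \<open>N\<close>, and
  differentiable maps preserve null sets.\<close>

lemma negligible_if_unique_along_flow:
  fixes \<phi> :: "real \<Rightarrow> 'a::euclidean_space \<Rightarrow> 'a"
  assumes N: "N \<in> sets borel"
    and cont: "continuous_on UNIV (\<lambda>(s, x). \<phi> s x)"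
    and unique: "\<And>x s t. \<phi> s x \<in> N \<Longrightarrow> \<phi> t x \<in> N \<Longrightarrow> s = t"
    and surj: "\<And>s. surj (\<phi> s)"
    and diff: "\<And>s. \<phi> s differentiable_on UNIV"
  shows "negligible N"
proof -
  have "continuous_on UNIV (\<lambda>p::'a \<times> real. \<phi> (snd p) (fst p))"
    using continuous_on_compose2[OF cont, of UNIV "\<lambda>p. (snd p, fst p)"]
    by (simp add: continuous_on_Pair continuous_on_fst continuous_on_snd)
  then have "(\<lambda>p::'a \<times> real. \<phi> (snd p) (fst p)) \<in> borel_measurable borel"
    by (rule borel_measurable_continuous_onI)
  then have "(\<lambda>p::'a \<times> real. \<phi> (snd p) (fst p)) -` (- N) \<inter> space borel \<in> sets borel"
    by (rule measurable_sets) (use N in auto)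
  moreover have "sets (lborel \<Otimes>\<^sub>M lborel) = sets (borel :: ('a \<times> real) measure)"
    by (metis lborel_prod sets_lborel)
  ultimately have meas: "{p \<in> space (lborel \<Otimes>\<^sub>M lborel). \<phi> (snd p) (fst p :: 'a) \<notin> N} \<in> sets (lborel \<Otimes>\<^sub>M lborel)"
    by (simp add: vimage_def space_pair_measure)
  have "AE s in lborel. \<phi> s x \<notin> N" for x
  proof (rule AE_I')
    show "{s. \<phi> s x \<in> N} \<in> null_sets lborel"
    proof (cases "{s. \<phi> s x \<in> N} = {}")
      case False
      then obtain t where "{s. \<phi> s x \<in> N} = {t}" using unique by blast
      then show ?thesis by (simp add: finite_imp_null_set_lborel)
    qed simp
  qed auto
  then have "AE x in lborel. AE s in lborel. \<phi> s x \<notin> N" by simp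
  then have "AE s in lborel. AE x in lborel. \<phi> s x \<notin> N"
    using lborel_pair.AE_commute[of "\<lambda>x s. \<phi> s x \<notin> N"] meas by simp
  \<comment> \<open>Lebesgue measure on the line is not zero, so a property of almost every time
    holds at some time.\<close>
  moreover have "ae_filter (lborel :: real measure) \<noteq> bot"
    by (simp add: ae_filter_eq_bot_iff)
  ultimately obtain s where s: "AE x in lborel. \<phi> s x \<notin> N"
    using eventually_happens by blast
  then obtain Z where "Z \<in> null_sets lborel" "{x. \<phi> s x \<in> N} \<subseteq> Z"
    by (auto simp: eventually_ae_filter)
  then have "negligible {x. \<phi> s x \<in> N}"
    by (metis negligible_iff_null_sets negligible_subset null_sets_completionI)
  then have "negligible (\<phi> s ` {x. \<phi> s x \<in> N})"
    using diff by (intro negligible_differentiable_image_negligible) (auto intro: differentiable_on_subset)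
  moreover have "N = \<phi> s ` {x. \<phi> s x \<in> N}" using surj[of s] by (metis (mono_tags) surj_image_vimage_eq vimage_def)
  ultimately show ?thesis by simp
qed

text \<open>The sum type merges column bounds (\<open>Inl\<close>) and box bounds
  (\<open>Inr\<close>) into the single indexed family that \<open>kkt\<close> expects.\<close>

definition constraint_vec :: "real^'p^'n \<Rightarrow> 'p + 'n \<Rightarrow> real^'n" where
  "constraint_vec X l = (case l of Inl j \<Rightarrow> column j X | Inr i \<Rightarrow> axis i 1)"

lemma constraint_vec_simps [simp]:
  "constraint_vec X (Inl j) = column j X"
  "constraint_vec X (Inr i) = axis i 1"
  by (auto simp: constraint_vec_def)

lemma has_derivative_column: "((\<lambda>X. column j (X :: real^'p^'n)) has_derivative column j) F"
  by (rule bounded_linear_imp_has_derivative, rule linear_conv_bounded_linear[THEN iffD1], rule linearI)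
    (auto simp: column_def vec_eq_iff)

lemma continuous_on_constraint_vec [continuous_intros]:
  assumes "continuous_on A f"
  shows "continuous_on A (\<lambda>x. constraint_vec (f x) l)"
  using assms by (cases l) (auto simp: column_def intro!: continuous_intros)

text \<open>The coefficients form a vector rather than a function so that the quantifiers range over a
  euclidean space.\<close>

lemma borel_solvable_combination:
  fixes f :: "((real^'n) \<times> (real^'p^'n)) \<times> (real^'n) \<Rightarrow> real^'n"
    and T A :: "('p::finite + 'n::finite) set"
  assumes "continuous_on UNIV f"
  shows "{p. \<exists>(a :: real^('p + 'n)) (u :: real^'n).
      (\<forall>l\<in>A. constraint_vec (snd p) l \<bullet> u = \<kappa> l) \<and>
      f (p, u) = (\<Sum>l\<in>T. a $ l *\<^sub>R constraint_vec (snd p) l)} \<in> sets borel"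
  (is "?N \<in> _")
proof -
  let ?C = "{q :: ((real^'n) \<times> (real^'p^'n)) \<times> ((real^('p + 'n)) \<times> (real^'n)).
    (\<forall>l\<in>A. constraint_vec (snd (fst q)) l \<bullet> snd (snd q) = \<kappa> l) \<and>
      f (fst q, snd (snd q)) = (\<Sum>l\<in>T. fst (snd q) $ l *\<^sub>R constraint_vec (snd (fst q)) l)}"
  have "closed {q :: ((real^'n) \<times> (real^'p^'n)) \<times> ((real^('p + 'n)) \<times> (real^'n)).
      constraint_vec (snd (fst q)) l \<bullet> snd (snd q) = \<kappa> l}" for l
    by (intro closed_Collect_eq continuous_intros)
  moreover have "continuous_on UNIV (\<lambda>q :: ((real^'n) \<times> (real^'p^'n)) \<times> ((real^('p + 'n)) \<times> (real^'n)).
      f (fst q, snd (snd q)))"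
    by (rule continuous_on_compose2[OF assms]) (auto intro!: continuous_intros)
  then have "closed {q :: ((real^'n) \<times> (real^'p^'n)) \<times> ((real^('p + 'n)) \<times> (real^'n)).
      f (fst q, snd (snd q)) = (\<Sum>l\<in>T. fst (snd q) $ l *\<^sub>R constraint_vec (snd (fst q)) l)}"
    by (rule closed_Collect_eq) (intro continuous_intros)
  moreover have "?C = (\<Inter>l\<in>A. {q. constraint_vec (snd (fst q)) l \<bullet> snd (snd q) = \<kappa> l}) \<inter>
      {q. f (fst q, snd (snd q)) = (\<Sum>l\<in>T. fst (snd q) $ l *\<^sub>R constraint_vec (snd (fst q)) l)}"
    by auto
  ultimately have closed: "closed ?C" by (metis (no_types, lifting) closed_INT closed_Int)
  have eq: "?N = fst ` ?C"
  proof (intro equalityI subsetI)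
    fix p assume "p \<in> ?N"
    then obtain a u where "(p, (a, u)) \<in> ?C" by auto
    then show "p \<in> fst ` ?C" by (rule image_eqI[rotated]) simp
  next
    fix p assume "p \<in> fst ` ?C"
    then obtain a u where "(p, (a, u)) \<in> ?C" by auto
    then show "p \<in> ?N" by auto
  qed
  show ?thesis
    unfolding eq by (rule borel_fst_image_closed[OF closed])
qed

lemma column_exp_scaled [simp]:
  "column l (\<chi> i m. exp (of_bool (m = j) * s) * X $ i $ m) =
    exp (of_bool (l = j) * s) *\<^sub>R column l X"
  by (simp add: column_def vec_eq_iff)

text \<open>Scaling column \<open>j\<close> leaves the normals in \<open>T\<close> unchanged. A
  dependence on them forces the inner product of column \<open>j\<close> with every solution of the
  equations on \<open>T\<close> to be one and the same number. The equation for column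
  \<open>j\<close> demands that this number times \<open>exp s\<close> be the nonzero value
  \<open>\<kappa> (Inl j)\<close>, which fixes \<open>s\<close>.\<close>

lemma negligible_dependent_active:
  fixes T :: "('p::finite + 'n::finite) set"
  assumes j: "Inl j \<notin> T" and \<kappa>: "\<kappa> (Inl j) \<noteq> 0"
  shows "negligible {p :: (real^'n) \<times> (real^'p^'n). \<exists>(a :: real^('p + 'n)) (u :: real^'n).
      (\<forall>l\<in>insert (Inl j) T. constraint_vec (snd p) l \<bullet> u = \<kappa> l) \<and>
      column j (snd p) = (\<Sum>l\<in>T. a $ l *\<^sub>R constraint_vec (snd p) l)}"
  (is "negligible ?N")
proof (rule negligible_if_unique_along_flow[of _
      "\<lambda>s p. (fst p, \<chi> i m. exp (of_bool (m = j) * s) * snd p $ i $ m)"])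
  show "?N \<in> sets borel"
    using borel_solvable_combination[of "\<lambda>q. constraint_vec (snd (fst q)) (Inl j)" "insert (Inl j) T" \<kappa> T]
       continuous_on_constraint_vec[of UNIV "\<lambda>q :: ((real^'n) \<times> (real^'p^'n)) \<times> (real^'n). snd (fst q)" "Inl j"]
    by (simp add: continuous_on_fst continuous_on_snd)
next
  show "continuous_on UNIV (\<lambda>(s, p :: (real^'n) \<times> (real^'p^'n)).
      (fst p, \<chi> i m. exp (of_bool (m = j) * s) * snd p $ i $ m))"
    unfolding case_prod_beta by (intro continuous_intros)
next
  fix s :: real
  have "exp (of_bool (m = j) * s) * (exp (- (of_bool (m = j) * s)) * x) = x" for m and x :: real
    by (simp flip: mult.assoc exp_add)
  then show "surj (\<lambda>p :: (real^'n) \<times> (real^'p^'n).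
      (fst p, \<chi> i m. exp (of_bool (m = j) * s) * snd p $ i $ m))"
    by (intro surjI[of _ "\<lambda>p. (fst p, \<chi> i m. exp (- (of_bool (m = j) * s)) * snd p $ i $ m)"])
      (simp add: vec_eq_iff prod_eq_iff)
  have "linear (\<lambda>p :: (real^'n) \<times> (real^'p^'n).
      (fst p, \<chi> i m. exp (of_bool (m = j) * s) * snd p $ i $ m))"
    by (rule linearI) (auto simp: vec_eq_iff algebra_simps)
  then show "(\<lambda>p :: (real^'n) \<times> (real^'p^'n).
      (fst p, \<chi> i m. exp (of_bool (m = j) * s) * snd p $ i $ m)) differentiable_on UNIV"
    by (rule linear_imp_differentiable_on)
next
  fix p :: "(real^'n) \<times> (real^'p^'n)" and s t
  let ?X = "\<lambda>s. \<chi> i m. exp (of_bool (m = j) * s) * snd p $ i $ m"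
  have unscaled: "constraint_vec (?X s) l = constraint_vec (snd p) l" if "l \<in> T" for l s
    using j that by (cases l) auto
  assume s: "(fst p, ?X s) \<in> ?N" and t: "(fst p, ?X t) \<in> ?N"
  obtain a u where a: "exp s *\<^sub>R column j (snd p) = (\<Sum>l\<in>T. a $ l *\<^sub>R constraint_vec (snd p) l)"
    and u: "exp s * (column j (snd p) \<bullet> u) = \<kappa> (Inl j)" "\<forall>l\<in>T. constraint_vec (snd p) l \<bullet> u = \<kappa> l"
    using s by (auto simp: unscaled cong: sum.cong)
  obtain w where w: "exp t * (column j (snd p) \<bullet> w) = \<kappa> (Inl j)"
    "\<forall>l\<in>T. constraint_vec (snd p) l \<bullet> w = \<kappa> l"
    using t by (auto simp: unscaled cong: sum.cong)
  \<comment> \<open>The right-hand side involves only the coefficients found at time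
    \<open>s\<close>, so it is the same for the witnesses \<open>u\<close> and
    \<open>w\<close>.\<close>
  have "exp s * (column j (snd p) \<bullet> x) = (\<Sum>l\<in>T. a $ l * \<kappa> l)"
    if "\<forall>l\<in>T. constraint_vec (snd p) l \<bullet> x = \<kappa> l" for x
    using arg_cong[OF a, of "\<lambda>y. y \<bullet> x"] that by (simp add: inner_sum_left cong: sum.cong)
  from this[OF u(2)] this[OF w(2)] u(1) w(1)
  have "exp s * (column j (snd p) \<bullet> w) = exp t * (column j (snd p) \<bullet> w)" by simp
  moreover have "column j (snd p) \<bullet> w \<noteq> 0" using w(1) \<kappa> by auto
  ultimately show "s = t" by simp
qed

text \<open>For two times along the normal of \<open>k\<close>, the difference of the witnesses is a
  combination of normals in \<open>insert k T\<close> and also orthogonal to all of them, hence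
  zero. Then \<open>s - t\<close> times the normal of \<open>k\<close> is a combination over
  \<open>T\<close>; removing the data where that normal itself is such a combination leaves only
  \<open>s = t\<close>.\<close>

lemma negligible_vanishing_coefficient:
  fixes T :: "('p::finite + 'n::finite) set" and k :: "'p + 'n"
  shows "negligible ({p :: (real^'n) \<times> (real^'p^'n). \<exists>(a :: real^('p + 'n)) (u :: real^'n).
      (\<forall>l\<in>insert k T. constraint_vec (snd p) l \<bullet> u = \<kappa> l) \<and>
      fst p - u = (\<Sum>l\<in>T. a $ l *\<^sub>R constraint_vec (snd p) l)} -
    {p. \<exists>a :: real^('p + 'n). constraint_vec (snd p) k = (\<Sum>l\<in>T. a $ l *\<^sub>R constraint_vec (snd p) l)})"
  (is "negligible (?N - ?D)")
proof (rule negligible_if_unique_along_flow[of _ "\<lambda>s p. (fst p + s *\<^sub>R constraint_vec (snd p) k, snd p)"])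
  have "?N \<in> sets borel"
    using borel_solvable_combination[of "\<lambda>q. fst (fst q) - snd q" "insert k T" \<kappa> T]
    by (simp add: continuous_on_diff continuous_on_fst continuous_on_snd)
  \<comment> \<open>With an empty set of equations the witness \<open>u\<close> is unconstrained,
    and only the dependence remains.\<close>
  moreover have "?D \<in> sets borel"
    using borel_solvable_combination[of "\<lambda>q. constraint_vec (snd (fst q)) k" "{}" \<kappa> T]
    by (simp add: continuous_on_constraint_vec continuous_on_fst continuous_on_snd)
  ultimately show "?N - ?D \<in> sets borel" by simp
next
  show "continuous_on UNIV (\<lambda>(s, p). (fst p + s *\<^sub>R constraint_vec (snd p) k, snd p))"
    unfolding case_prod_beta by (intro continuous_intros)
next
  fix s :: real
  show "surj (\<lambda>p :: (real^'n) \<times> (real^'p^'n). (fst p + s *\<^sub>R constraint_vec (snd p) k, snd p))"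
    by (rule surjI[of _ "\<lambda>p. (fst p - s *\<^sub>R constraint_vec (snd p) k, snd p)"]) simp
  have "(\<lambda>p :: (real^'n) \<times> (real^'p^'n). constraint_vec (snd p) k) differentiable at p" for p
  proof (cases k)
    case (Inl j)
    have "((\<lambda>p :: (real^'n) \<times> (real^'p^'n). column j (snd p)) has_derivative (\<lambda>p. column j (snd p))) (at p)"
      by (intro has_derivative_compose[OF _ has_derivative_column] derivative_intros)
    then show ?thesis using Inl by (auto simp: differentiable_def)
  qed simp
  then obtain F where F: "\<And>p. ((\<lambda>p :: (real^'n) \<times> (real^'p^'n). constraint_vec (snd p) k)
      has_derivative F p) (at p)"
    unfolding differentiable_def by metis
  have "((\<lambda>p :: (real^'n) \<times> (real^'p^'n). (fst p + s *\<^sub>R constraint_vec (snd p) k, snd p))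
      has_derivative (\<lambda>h. (fst h + s *\<^sub>R F p h, snd h))) (at p)" for p
    by (intro has_derivative_Pair has_derivative_add has_derivative_scaleR_right
        has_derivative_fst has_derivative_snd has_derivative_ident F)
  then show "(\<lambda>p :: (real^'n) \<times> (real^'p^'n). (fst p + s *\<^sub>R constraint_vec (snd p) k, snd p))
      differentiable_on UNIV"
    by (intro differentiable_at_imp_differentiable_on differentiableI)
next
  fix p :: "(real^'n) \<times> (real^'p^'n)" and s t
  let ?v = "constraint_vec (snd p)"
  assume s: "(fst p + s *\<^sub>R ?v k, snd p) \<in> ?N - ?D" and t: "(fst p + t *\<^sub>R ?v k, snd p) \<in> ?N - ?D"
  obtain a u where a: "\<forall>l\<in>insert k T. ?v l \<bullet> u = \<kappa> l"
    "fst p + s *\<^sub>R ?v k - u = (\<Sum>l\<in>T. a $ l *\<^sub>R ?v l)"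
    using s by auto
  obtain b w where b: "\<forall>l\<in>insert k T. ?v l \<bullet> w = \<kappa> l"
    "fst p + t *\<^sub>R ?v k - w = (\<Sum>l\<in>T. b $ l *\<^sub>R ?v l)"
    using t by auto
  have diff: "u - w = (s - t) *\<^sub>R ?v k - (\<Sum>l\<in>T. (a - b) $ l *\<^sub>R ?v l)"
  proof -
    have "(s - t) *\<^sub>R ?v k - (u - w) = (fst p + s *\<^sub>R ?v k - u) - (fst p + t *\<^sub>R ?v k - w)"
      by (simp add: scaleR_diff_left)
    also have "\<dots> = (\<Sum>l\<in>T. (a - b) $ l *\<^sub>R ?v l)"
      unfolding a(2) b(2) by (simp add: scaleR_diff_left sum_subtractf)
    finally show ?thesis by (simp add: algebra_simps)
  qed
  have orth: "?v l \<bullet> (u - w) = 0" if "l \<in> insert k T" for l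
    using a(1) b(1) that by (auto simp: inner_diff_right)
  \<comment> \<open>Only the first factor is expanded by \<open>diff\<close>; each resulting term is
    orthogonal to the second factor.\<close>
  have "(u - w) \<bullet> (u - w) = 0"
    by (subst (1) diff) (simp add: inner_diff_left inner_sum_left orth del: inner_eq_zero_iff)
  then have eq: "(s - t) *\<^sub>R ?v k = (\<Sum>l\<in>T. (a - b) $ l *\<^sub>R ?v l)" using diff by simp
  show "s = t"
  proof (rule ccontr)
    assume "s \<noteq> t"
    then have "?v k = inverse (s - t) *\<^sub>R ((s - t) *\<^sub>R ?v k)" by simp
    also have "\<dots> = (\<Sum>l\<in>T. (inverse (s - t) *\<^sub>R (a - b)) $ l *\<^sub>R ?v l)"
      unfolding eq by (simp add: scaleR_sum_right)
    finally have "\<exists>a :: real^('p + 'n). ?v k = (\<Sum>l\<in>T. a $ l *\<^sub>R ?v l)" by (rule exI)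
    with s show False by simp
  qed
qed

section \<open>Optimality conditions\<close>

lemma l1_norm_add_axis:
  "l1_norm (b + e *\<^sub>R axis j 1) = l1_norm b - \<bar>b $ j\<bar> + \<bar>b $ j + e\<bar>"
proof -
  have "l1_norm (b + e *\<^sub>R axis j 1) = (\<Sum>k\<in>UNIV. \<bar>b $ k\<bar> + (if k = j then \<bar>b $ j + e\<bar> - \<bar>b $ j\<bar> else 0))"
    unfolding l1_norm_def by (intro sum.cong) (auto simp: axis_def)
  then show ?thesis by (simp add: sum.distrib l1_norm_def)
qed

lemma resid_add_axis: "resid y X (b + e *\<^sub>R axis j 1) i = resid y X b i - e * X $ i $ j"
  by (simp add: resid_def inner_add_right inner_axis row_def)

text \<open>Half-widths of the slabs. The factor \<open>CARD('n)\<close> in the first case clears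
  the averaging factor of the loss in the stationarity condition.\<close>

definition constraint_bound :: "real \<Rightarrow> real \<Rightarrow> 'p + 'n::finite \<Rightarrow> real" where
  "constraint_bound ls lam l =
    (case l of Inl _ \<Rightarrow> real CARD('n) * lam | Inr _ \<Rightarrow> sqrt (real CARD('n)) * ls)"

definition multiplier :: "real \<Rightarrow> real^'n \<Rightarrow> real^'p^'n \<Rightarrow> real^'p \<Rightarrow> 'p + 'n \<Rightarrow> real" where
  "multiplier ls y X b l =
    (case l of Inl j \<Rightarrow> b $ j | Inr i \<Rightarrow> resid y X b i - psi CARD('n) ls (resid y X b i))"

text \<open>The objective is varied along one coordinate axis. The smooth part has slope
  \<open>- G / n\<close>, and the one-sided slopes of the penalty are at most \<open>lam\<close>,
  which gives the bound. At a nonzero coordinate the penalty is differentiable, so the total slope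
  vanishes.\<close>

lemma minimizer_stationary:
  fixes y :: "real^'n" and X :: "real^'p^'n"
  assumes "ls > 0" "lam > 0"
    and min: "is_arg_min (huber_lasso_objective ls lam y X) (\<lambda>_. True) b"
  shows "\<bar>column j X \<bullet> psi_vec ls y X b\<bar> \<le> real CARD('n) * lam"
    and "b $ j \<noteq> 0 \<Longrightarrow> column j X \<bullet> psi_vec ls y X b = real CARD('n) * lam * sgn (b $ j)"
proof -
  define n where "n = real CARD('n)"
  have n: "n > 0" by (simp add: n_def)
  define G where "G = column j X \<bullet> psi_vec ls y X b"
  define g where "g = (\<lambda>e. 1 / n * (\<Sum>i\<in>UNIV. scaled_huber CARD('n) ls (resid y X b i - e * X $ i $ j)))"
  have "(scaled_huber CARD('n) ls has_real_derivative psi CARD('n) ls u) (at u)" for u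
    using has_real_derivative_scaled_huber[of "CARD('n)" ls u] psi_eq[of "CARD('n)" ls] assms(1) by simp
  note huber_chain = DERIV_chain2[OF this]
  have "((\<lambda>e. scaled_huber CARD('n) ls (resid y X b i - e * X $ i $ j)) has_real_derivative
      psi CARD('n) ls (resid y X b i - 0 * X $ i $ j) * - (X $ i $ j)) (at 0)" for i
    by (rule huber_chain) (auto intro!: derivative_eq_intros)
  then have "(g has_real_derivative 1 / n * (\<Sum>i\<in>UNIV. psi CARD('n) ls (resid y X b i - 0 * X $ i $ j) * - (X $ i $ j))) (at 0)"
    unfolding g_def by (intro DERIV_cmult DERIV_sum)
  moreover have "1 / n * (\<Sum>i\<in>UNIV. psi CARD('n) ls (resid y X b i - 0 * X $ i $ j) * - (X $ i $ j)) = - G / n"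
    by (simp add: G_def inner_vec_def column_def psi_vec_def sum_negf mult.commute)
  ultimately have g: "(g has_real_derivative - G / n) (at 0)" by simp
  have le: "g 0 + lam * \<bar>b $ j\<bar> \<le> g e + lam * \<bar>b $ j + e\<bar>" for e
  proof -
    have "huber_lasso_objective ls lam y X b \<le> huber_lasso_objective ls lam y X (b + e *\<^sub>R axis j 1)"
      using min by (simp add: is_arg_min_linorder)
    then show ?thesis
      by (simp add: huber_lasso_objective_def g_def n_def l1_norm_add_axis resid_add_axis algebra_simps)
  qed
  \<comment> \<open>Otherwise a small step to the right, here \<open>d / 2\<close>, would decrease
    the objective, since the penalty grows at most linearly; the next bound is the mirror image to
    the left.\<close>
  have "0 \<le> - G / n + lam"
  proof (rule ccontr)
    assume "\<not> 0 \<le> - G / n + lam"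
    moreover have "((\<lambda>e. g e + lam * e) has_real_derivative - G / n + lam) (at 0)"
      by (auto intro!: derivative_eq_intros g)
    ultimately obtain d where "d > 0" and d: "\<And>h. 0 < h \<Longrightarrow> h < d \<Longrightarrow> g h + lam * h < g 0"
      using DERIV_neg_dec_right[of "\<lambda>e. g e + lam * e" "- G / n + lam" 0] by auto
    have "g (d / 2) + lam * (d / 2) < g 0" using d[of "d / 2"] \<open>d > 0\<close> by simp
    moreover have "lam * \<bar>b $ j + d / 2\<bar> \<le> lam * (\<bar>b $ j\<bar> + d / 2)"
      using assms(2) \<open>d > 0\<close> by (intro mult_left_mono) auto
    ultimately show False using le[of "d / 2"] by (simp add: distrib_left)
  qed
  moreover have "- G / n - lam \<le> 0"
  proof (rule ccontr)
    assume "\<not> - G / n - lam \<le> 0"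
    moreover have "((\<lambda>e. g e - lam * e) has_real_derivative - G / n - lam) (at 0)"
      by (auto intro!: derivative_eq_intros g)
    ultimately obtain d where "d > 0" and d: "\<And>h. 0 < h \<Longrightarrow> h < d \<Longrightarrow> g (- h) + lam * h < g 0"
      using DERIV_pos_inc_left[of "\<lambda>e. g e - lam * e" "- G / n - lam" 0] by auto
    have "g (- (d / 2)) + lam * (d / 2) < g 0" using d[of "d / 2"] \<open>d > 0\<close> by simp
    moreover have "lam * \<bar>b $ j - d / 2\<bar> \<le> lam * (\<bar>b $ j\<bar> + d / 2)"
      using assms(2) \<open>d > 0\<close> by (intro mult_left_mono) auto
    ultimately show False using le[of "- (d / 2)"] by (simp add: distrib_left)
  qed
  ultimately have "\<bar>G / n\<bar> \<le> lam" by simp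
  then show "\<bar>column j X \<bullet> psi_vec ls y X b\<bar> \<le> real CARD('n) * lam"
    using n by (simp add: G_def n_def abs_divide field_simps)
  assume nz: "b $ j \<noteq> 0"
  \<comment> \<open>Within radius \<open>\<bar>b $ j\<bar>\<close> the coordinate keeps its sign, so
    the absolute value agrees there with a linear function.\<close>
  have "- G / n + lam * sgn (b $ j) = 0"
  proof (rule DERIV_local_min)
    show "((\<lambda>e. g e + lam * (sgn (b $ j) * (b $ j + e))) has_real_derivative - G / n + lam * sgn (b $ j)) (at 0)"
      by (auto intro!: derivative_eq_intros g)
    show "0 < \<bar>b $ j\<bar>" using nz by simp
    show "\<forall>e. \<bar>0 - e\<bar> < \<bar>b $ j\<bar> \<longrightarrow>
        g 0 + lam * (sgn (b $ j) * (b $ j + 0)) \<le> g e + lam * (sgn (b $ j) * (b $ j + e))"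
    proof (intro allI impI)
      fix e assume "\<bar>0 - e\<bar> < \<bar>b $ j\<bar>"
      then have "sgn (b $ j) * (b $ j + e) = \<bar>b $ j + e\<bar>" "sgn (b $ j) * (b $ j + 0) = \<bar>b $ j\<bar>"
        by (auto simp: sgn_if abs_if split: if_splits)
      then show "g 0 + lam * (sgn (b $ j) * (b $ j + 0)) \<le> g e + lam * (sgn (b $ j) * (b $ j + e))"
        using le[of e] by simp
    qed
  qed
  then have "G = n * (lam * sgn (b $ j))" using n by (simp add: field_simps)
  then show "column j X \<bullet> psi_vec ls y X b = real CARD('n) * lam * sgn (b $ j)"
    by (simp add: G_def n_def)
qed

text \<open>Here \<open>y\<close> is fit plus residual, and the residual is its clipped value plus
  an excess. The fit supplies the column multipliers and the excess the box multipliers, which are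
  nonzero only where clipping is active.\<close>

lemma minimizer_kkt:
  fixes y :: "real^'n" and X :: "real^'p^'n"
  assumes "ls > 0" "lam > 0"
    and min: "is_arg_min (huber_lasso_objective ls lam y X) (\<lambda>_. True) b"
  shows "kkt (constraint_vec X) (constraint_bound ls lam) y (psi_vec ls y X b) (multiplier ls y X b)"
  unfolding kkt_def
proof (intro conjI allI impI)
  define c where "c = sqrt (real CARD('n)) * ls"
  have c: "c > 0" using assms(1) by (simp add: c_def)
  have psi: "psi CARD('n) ls u = max (- c) (min u c)" for u
    using psi_eq[of "CARD('n)" ls] assms(1) by (simp add: c_def)
  show "y - psi_vec ls y X b = (\<Sum>l\<in>UNIV. multiplier ls y X b l *\<^sub>R constraint_vec X l)"
  proof -
    have "(\<Sum>l\<in>UNIV. multiplier ls y X b l *\<^sub>R constraint_vec X l) $ i = (y - psi_vec ls y X b) $ i" for i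
    proof -
      have "(\<Sum>l\<in>UNIV. multiplier ls y X b l *\<^sub>R constraint_vec X l) $ i =
          (\<Sum>l\<in>UNIV <+> UNIV. multiplier ls y X b l * constraint_vec X l $ i)"
        by simp
      also have "\<dots> = (\<Sum>j\<in>UNIV. b $ j * X $ i $ j) +
          (\<Sum>k\<in>UNIV. (resid y X b k - psi CARD('n) ls (resid y X b k)) * (if i = k then 1 else 0))"
        by (subst sum.Plus) (auto simp: multiplier_def column_def axis_def)
      also have "(\<Sum>j\<in>UNIV. b $ j * X $ i $ j) = row i X \<bullet> b"
        by (simp add: inner_vec_def row_def mult.commute)
      finally show ?thesis
        by (simp add: psi_vec_def resid_def if_distrib[of "(*) _"] cong: if_cong)
    qed
    then show ?thesis by (simp add: vec_eq_iff)
  qed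
  show "\<bar>constraint_vec X l \<bullet> psi_vec ls y X b\<bar> \<le> constraint_bound ls lam l" for l
    using minimizer_stationary(1)[OF assms] c
    by (cases l) (auto simp: constraint_bound_def inner_axis_axis inner_axis' psi_vec_def psi simp flip: c_def)
  show "constraint_vec X l \<bullet> psi_vec ls y X b = constraint_bound ls lam l * sgn (multiplier ls y X b l)"
    if "multiplier ls y X b l \<noteq> 0" for l
    using minimizer_stationary(2)[OF assms] c that
    by (cases l) (auto simp: multiplier_def constraint_bound_def inner_axis' psi_vec_def psi max_def min_def
        simp flip: c_def split: if_splits)
qed

section \<open>Generic data\<close>

text \<open>Degenerate data lie in a finite union of null sets, indexed by constraints, active sets
  and sign patterns: \<open>N1\<close> captures dependent active normals, \<open>N2\<close> active
  constraints with multiplier zero.\<close>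

lemma AE_nondegenerate:
  fixes ls lam :: real
  assumes "ls > 0" "lam > 0"
  shows "AE p in (lborel :: ((real^'n) \<times> (real^'p^'n)) measure).
    \<forall>u a T. kkt (constraint_vec (snd p)) (constraint_bound ls lam) (fst p) u a \<longrightarrow>
      T = {l. \<bar>constraint_vec (snd p) l \<bullet> u\<bar> = constraint_bound ls lam l} \<longrightarrow>
      (\<forall>k\<in>T. constraint_vec (snd p) k \<notin> span (constraint_vec (snd p) ` (T - {k})) \<and> a k \<noteq> 0)"
proof -
  define c :: "'p + 'n \<Rightarrow> real" where "c = constraint_bound ls lam"
  \<comment> \<open>A sign pattern turns the condition that an absolute value attains its bound into
    a linear equation.\<close>
  define \<kappa> where "\<kappa> = (\<lambda>(\<sigma> :: 'p + 'n \<Rightarrow> bool) l. if \<sigma> l then c l else - c l)"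
  have c: "c l > 0" for l using assms by (cases l) (auto simp: c_def constraint_bound_def)
  define N where "N = (\<lambda>\<sigma> A T (f :: (real^'n) \<times> (real^'p^'n) \<Rightarrow> real^'n \<Rightarrow> real^'n).
    {p. \<exists>(a :: real^('p + 'n)) (u :: real^'n).
      (\<forall>l\<in>A. constraint_vec (snd p) l \<bullet> u = \<kappa> \<sigma> l) \<and>
      f p u = (\<Sum>l\<in>T. a $ l *\<^sub>R constraint_vec (snd p) l)})"
  define Dep where "Dep = (\<lambda>k T. {p :: (real^'n) \<times> (real^'p^'n). \<exists>a :: real^('p + 'n).
    constraint_vec (snd p) k = (\<Sum>l\<in>T. a $ l *\<^sub>R constraint_vec (snd p) l)})"
  define N1 where "N1 = (\<Union>(j, T, \<sigma>)\<in>{(j, T, \<sigma>). Inl j \<notin> T}.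
    N \<sigma> (insert (Inl j) T) T (\<lambda>p u. column j (snd p)))"
  define N2 where "N2 = (\<Union>(k, T, \<sigma>)\<in>UNIV. N \<sigma> (insert k T) T (\<lambda>p u. fst p - u) - Dep k T)"
  have "negligible N1"
    unfolding N1_def
  proof (rule negligible_Union, goal_cases)
    case (2 A)
    then obtain j T \<sigma> where "Inl j \<notin> T" and A: "A = N \<sigma> (insert (Inl j) T) T (\<lambda>p u. column j (snd p))"
      by auto
    moreover have "\<kappa> \<sigma> (Inl j) \<noteq> 0" using c[of "Inl j"] by (simp add: \<kappa>_def)
    ultimately show ?case
      unfolding A N_def by (intro negligible_dependent_active)
  qed simp
  moreover have "negligible N2"
    unfolding N2_def
  proof (rule negligible_Union, goal_cases)
    case (2 A)
    then obtain k T \<sigma> where A: "A = N \<sigma> (insert k T) T (\<lambda>p u. fst p - u) - Dep k T"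
      by auto
    show ?case
      unfolding A N_def Dep_def by (rule negligible_vanishing_coefficient)
  qed simp
  ultimately have "negligible (N1 \<union> N2)" by (rule negligible_Un)
  then obtain Z where Z: "Z \<in> null_sets lborel" "N1 \<union> N2 \<subseteq> Z"
    by (auto simp: negligible_iff_null_sets null_sets_completion_iff2)
  have N1I: "p \<in> N1" if "Inl j \<notin> T" "\<forall>l\<in>insert (Inl j) T. constraint_vec (snd p) l \<bullet> u = \<kappa> \<sigma> l"
    "column j (snd p) = (\<Sum>l\<in>T. a l *\<^sub>R constraint_vec (snd p) l)" for p j T \<sigma> u a
  proof -
    have "p \<in> N \<sigma> (insert (Inl j) T) T (\<lambda>p u. column j (snd p))"
      unfolding N_def using that(2,3) by (intro CollectI exI[of _ "\<chi> l. a l"] exI[of _ u]) simp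
    then show ?thesis unfolding N1_def using that(1) by blast
  qed
  have N2I: "p \<in> N2" if "constraint_vec (snd p) k \<notin> span (constraint_vec (snd p) ` T)"
    "\<forall>l\<in>insert k T. constraint_vec (snd p) l \<bullet> u = \<kappa> \<sigma> l"
    "fst p - u = (\<Sum>l\<in>T. a l *\<^sub>R constraint_vec (snd p) l)" for p k T \<sigma> u a
  proof -
    have "p \<in> N \<sigma> (insert k T) T (\<lambda>p u. fst p - u)"
      unfolding N_def using that(2,3) by (intro CollectI exI[of _ "\<chi> l. a l"] exI[of _ u]) simp
    moreover have "p \<notin> Dep k T"
    proof
      assume "p \<in> Dep k T"
      then obtain b :: "real^('p + 'n)" where
        "constraint_vec (snd p) k = (\<Sum>l\<in>T. b $ l *\<^sub>R constraint_vec (snd p) l)"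
        unfolding Dep_def by auto
      with that(1) show False by (simp add: span_sum span_scale span_base)
    qed
    ultimately show ?thesis unfolding N2_def by blast
  qed
  show ?thesis
  proof (rule AE_I'[OF Z(1)], rule subset_trans[OF _ Z(2)], rule subsetI, rule ccontr, elim CollectE conjE,
      erule notE, intro allI impI)
    fix p :: "(real^'n) \<times> (real^'p^'n)" and u a T
    let ?v = "constraint_vec (snd p)"
    assume p: "p \<notin> N1 \<union> N2" and k: "kkt ?v (constraint_bound ls lam) (fst p) u a"
      and T: "T = {l. \<bar>?v l \<bullet> u\<bar> = constraint_bound ls lam l}"
    define \<sigma> where "\<sigma> = (\<lambda>l. ?v l \<bullet> u > 0)"
    have act: "?v l \<bullet> u = \<kappa> \<sigma> l" if "l \<in> T" for l
      using that by (auto simp: T \<kappa>_def \<sigma>_def c_def)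
    have inact: "a l = 0" if "l \<notin> T" for l
    proof (rule kkt_inactive[OF k])
      show "\<bar>?v l \<bullet> u\<bar> < constraint_bound ls lam l"
        using k that unfolding kkt_def T by (metis (mono_tags) mem_Collect_eq order_less_le)
    qed
    have indep: "?v k \<notin> span (?v ` (T - {k}))" if "k \<in> T" for k
    proof
      assume "?v k \<in> span (?v ` (T - {k}))"
      then obtain b where b: "?v k = (\<Sum>l\<in>T - {k}. b l *\<^sub>R ?v l)"
        using span_image_imp_combination[of "T - {k}" "?v k" ?v] by auto
      define e where "e = (\<lambda>l. if l = k then 1 else - b l)"
      have "(\<Sum>l\<in>T - {k}. e l *\<^sub>R ?v l) = - (\<Sum>l\<in>T - {k}. b l *\<^sub>R ?v l)"
        unfolding sum_negf[symmetric] by (intro sum.cong) (auto simp: e_def)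
      moreover have "e k = 1" by (simp add: e_def)
      ultimately have zero: "(\<Sum>l\<in>T. e l *\<^sub>R ?v l) = 0"
        using that b by (simp add: sum.remove[of T k])
      show False
      \<comment> \<open>If some column enters the relation, solving for it puts \<open>p\<close>
        into \<open>N1\<close>. Otherwise the relation involves coordinate vectors only; then
        \<open>k = Inr i\<close>, and component \<open>i\<close> reads 0 = 1.\<close>
      proof (cases "\<exists>j. Inl j \<in> T \<and> e (Inl j) \<noteq> 0")
        case True
        then obtain j where j: "Inl j \<in> T" "e (Inl j) \<noteq> 0" by blast
        have "e (Inl j) *\<^sub>R column j (snd p) = - (\<Sum>l\<in>T - {Inl j}. e l *\<^sub>R ?v l)"
          using zero j(1) by (simp add: sum.remove[of T "Inl j"] eq_neg_iff_add_eq_0)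
        then have "inverse (e (Inl j)) *\<^sub>R e (Inl j) *\<^sub>R column j (snd p) =
            inverse (e (Inl j)) *\<^sub>R - (\<Sum>l\<in>T - {Inl j}. e l *\<^sub>R ?v l)" by simp
        then have col: "column j (snd p) = (\<Sum>l\<in>T - {Inl j}. (- inverse (e (Inl j)) * e l) *\<^sub>R ?v l)"
          using j(2) by (simp add: scaleR_sum_right sum_negf)
        have "p \<in> N1"
          by (rule N1I[of j "T - {Inl j}" p u \<sigma>, OF _ _ col]) (use act j(1) act[OF j(1)] in auto)
        with p show False by simp
      next
        case False
        have "k \<noteq> Inl j" for j
        proof
          assume kj: "k = Inl j"
          have "Inl j \<in> T" "e (Inl j) = 1" using \<open>k \<in> T\<close> \<open>e k = 1\<close> unfolding kj .
          with False show False by simp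
        qed
        then obtain i where i: "k = Inr i" by (cases k) blast+
        have "0 = (\<Sum>l\<in>T. e l *\<^sub>R ?v l) $ i" by (simp add: zero)
        also have "\<dots> = (\<Sum>l\<in>T. if l = k then 1 else 0)"
          unfolding sum_component
        proof (rule sum.cong[OF refl])
          fix l assume "l \<in> T"
          then show "(e l *\<^sub>R ?v l) $ i = (if l = k then 1 else 0)"
            using False i by (cases l) (auto simp: axis_def e_def)
        qed
        also have "\<dots> = 1" using that by simp
        finally show False by simp
      qed
    qed
    have "a k \<noteq> 0" if "k \<in> T" for k
    proof
      assume "a k = 0"
      then have "(\<Sum>l\<in>UNIV. a l *\<^sub>R ?v l) = (\<Sum>l\<in>T - {k}. a l *\<^sub>R ?v l)"
        using inact by (intro sum.mono_neutral_right) auto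
      then have "p \<in> N2"
        using k act that indep[OF that] by (intro N2I[of p k "T - {k}" u \<sigma>]) (auto simp: kkt_def)
      with p show False by simp
    qed
    with indep show "\<forall>k\<in>T. ?v k \<notin> span (?v ` (T - {k})) \<and> a k \<noteq> 0" by blast
  qed
qed

section \<open>Jacobians of locally affine maps and the deterministic conclusion\<close>

lemma has_derivative_locally_affine:
  fixes f :: "real^'n \<Rightarrow> real^'m"
  assumes "\<forall>\<^sub>F z in nhds y. f z = f y + A *v (z - y)"
  shows "(f has_derivative (*v) A) (at y)"
proof -
  have "((\<lambda>z. f y + A *v (z - y)) has_derivative (\<lambda>h. A *v h)) (at y)"
    by (auto intro!: derivative_eq_intros bounded_linear.has_derivative[OF matrix_vector_mul_bounded_linear])
  moreover have "\<forall>\<^sub>F z in at y. f y + A *v (z - y) = f z"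
    using assms by (auto simp: eventually_at_filter elim: eventually_mono)
  ultimately show ?thesis
    by (rule has_derivative_transform_eventually) simp_all
qed

lemma jacobian_locally_affine:
  fixes f :: "real^'n \<Rightarrow> real^'m"
  assumes "\<forall>\<^sub>F z in nhds y. f z = f y + A *v (z - y)"
  shows "f differentiable at y" "jacobian f (at y) = A"
proof -
  note D = has_derivative_locally_affine[OF assms]
  show "f differentiable at y" by (rule differentiableI[OF D])
  show "jacobian f (at y) = A"
    unfolding jacobian_def frechet_derivative_at[OF D, symmetric] by simp
qed

lemma inner_mult_vec_eq_0_if_eventually:
  fixes A :: "real^'n^'m"
  assumes "\<forall>\<^sub>F z in nhds y. w \<bullet> (A *v (z - y)) = 0"
  shows "w \<bullet> (A *v h) = 0"
proof -
  obtain e where e: "e > 0" "\<And>z. dist z y < e \<Longrightarrow> w \<bullet> (A *v (z - y)) = 0"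
    using assms unfolding eventually_nhds_metric by auto
  \<comment> \<open>A multiple of \<open>h\<close> small enough for the neighbourhood; the added 1
    covers \<open>h = 0\<close>. Linearity removes \<open>r\<close> again.\<close>
  define r where "r = e / (2 * (norm h + 1))"
  have "r > 0" using e(1) by (simp add: r_def add_nonneg_pos)
  have "r * norm h < e"
  proof -
    have "r * norm h \<le> r * (norm h + 1)" using \<open>r > 0\<close> by simp
    also have "\<dots> = e / 2" by (simp add: r_def field_simps add_nonneg_eq_0_iff)
    finally show ?thesis using e(1) by simp
  qed
  then have "w \<bullet> (A *v (r *\<^sub>R h)) = 0"
    using e(2)[of "y + r *\<^sub>R h"] \<open>r > 0\<close> by (simp add: dist_norm)
  then show ?thesis using \<open>r > 0\<close> by (simp add: matrix_vector_mult_scaleR)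
qed

lemma orthogonal_projection_if_biorthogonal:
  fixes A :: "real^'n^'n"
  assumes "\<And>h. A *v h \<in> span (g ` S)" "\<And>h j. j \<in> S \<Longrightarrow> (h - A *v h) \<bullet> g j = 0"
  shows "is_orthogonal_projection A (span (g ` S))"
  unfolding is_orthogonal_projection_def
proof (intro allI conjI ballI)
  fix h w assume "w \<in> span (g ` S)"
  then have "(h - A *v h) \<bullet> w = 0"
    by (induction rule: span_induct) (auto simp: subspace_def inner_add_right assms(2))
  then show "orthogonal (h - A *v h) w" by (simp add: orthogonal_def)
qed (rule assms(1))

text \<open>The deterministic half: genericity enters only through \<open>indep\<close> and
  \<open>nz\<close> at the one point \<open>(y, X)\<close>, while the optimality conditions hold at
  all neighbouring \<open>z\<close>.\<close>

lemma nondegenerate_conclusion: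
  fixes ls lam :: real
    and bhat :: "real^'n \<Rightarrow> real^'p^'n \<Rightarrow> real^'p"
    and y :: "real^'n" and X :: "real^'p^'n"
  assumes ls: "ls > 0" and lam: "lam > 0"
    and min: "\<And>y X. is_arg_min (huber_lasso_objective ls lam y X) (\<lambda>_. True) (bhat y X)"
    and T: "T = {l. \<bar>constraint_vec X l \<bullet> psi_vec ls y X (bhat y X)\<bar> = constraint_bound ls lam l}"
    and indep: "\<And>k. k \<in> T \<Longrightarrow> constraint_vec X k \<notin> span (constraint_vec X ` (T - {k}))"
    and nz: "\<And>k. k \<in> T \<Longrightarrow> multiplier ls y X (bhat y X) k \<noteq> 0"
  defines "I \<equiv> inliers ls y X (bhat y X)"
    and "S \<equiv> coord_support (bhat y X)"
    and "D \<equiv> diag_psi' ls y X (bhat y X)"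
    and "J \<equiv> jacobian (\<lambda>z. X *v bhat z X) (at y)"
    and "Jpsi \<equiv> jacobian (\<lambda>z. psi_vec ls z X (bhat z X)) (at y)"
  shows "\<forall>i. psi CARD('n) ls differentiable at (resid y X (bhat y X) i)"
    and "\<forall>\<^sub>F z in nhds y. inliers ls z X (bhat z X) = I"
    and "\<forall>\<^sub>F z in nhds y. coord_support (bhat z X) = S"
    and "\<forall>\<^sub>F z in nhds y. diag_psi' ls z X (bhat z X) = D"
    and "(\<lambda>z. X *v bhat z X) differentiable at y"
    and "is_orthogonal_projection (D ** J) (col_span_on D X S)"
    and "(\<lambda>z. psi_vec ls z X (bhat z X)) differentiable at y"
    and "Jpsi = D - D ** J"
    and "trace J = trace (D ** J)"
    and "trace (D ** J) = real (card S)"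
    and "trace Jpsi = real (card I) - real (card S)"
    and "real (card I) - real (card S) \<ge> 0"
proof -
  define v where "v = constraint_vec X"
  define u where "u = (\<lambda>z. psi_vec ls z X (bhat z X))"
  define a where "a = (\<lambda>z. multiplier ls z X (bhat z X))"
  define r where "r = (\<lambda>z. resid z X (bhat z X))"
  define c where "c = sqrt (real CARD('n)) * ls"
  have c: "c > 0" using ls by (simp add: c_def)
  have psi: "psi CARD('n) ls x = max (- c) (min x c)" for x
    using psi_eq[of "CARD('n)" ls] ls by (simp add: c_def)
  have psi': "psi' CARD('n) ls x = of_bool (\<bar>x\<bar> < c)" if "\<bar>x\<bar> \<noteq> c" for x
    using psi'_eq[of "CARD('n)" ls x] ls that by (simp add: c_def)
  have kkt: "kkt v (constraint_bound ls lam) z (u z) (a z)" for z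
    unfolding v_def u_def a_def by (rule minimizer_kkt[OF ls lam min])
  obtain d where d_span: "\<And>l. l \<in> T \<Longrightarrow> d l \<in> span (v ` T)"
    and dual: "\<And>l m. l \<in> T \<Longrightarrow> m \<in> T \<Longrightarrow> d l \<bullet> v m = of_bool (l = m)"
    using dual_family_exists[of T v] indep unfolding v_def by auto
  have "\<forall>\<^sub>F z in nhds y. \<forall>w b. kkt v (constraint_bound ls lam) z w b \<longrightarrow>
      (\<forall>l\<in>T. b l \<noteq> 0 \<and> b l = a y l + d l \<bullet> (z - y) \<and> v l \<bullet> w = v l \<bullet> u y) \<and>
      (\<forall>l. l \<notin> T \<longrightarrow> b l = 0 \<and> \<bar>v l \<bullet> w\<bar> < constraint_bound ls lam l)"
    using nz by (intro kkt_locally_affine[OF kkt _ _ d_span dual])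
      (auto simp: T v_def u_def a_def)
  then have loc: "\<forall>\<^sub>F z in nhds y.
      (\<forall>l\<in>T. a z l \<noteq> 0 \<and> a z l = a y l + d l \<bullet> (z - y) \<and> v l \<bullet> u z = v l \<bullet> u y) \<and>
      (\<forall>l. l \<notin> T \<longrightarrow> a z l = 0 \<and> \<bar>v l \<bullet> u z\<bar> < constraint_bound ls lam l)"
    by eventually_elim (use kkt in blast)
  \<comment> \<open>The clipped observations, whose complement turns out to be the inliers.\<close>
  define B where "B = {i. Inr i \<in> T}"
  define S' where "S' = {j. Inl j \<in> T}"
  define D' :: "real^'n^'n" where "D' = (\<chi> i k. if i = k then of_bool (i \<notin> B) else 0)"
  \<comment> \<open>The future Jacobian of \<open>bhat\<close> in \<open>y\<close>: dual vectors as
    rows on the support, zero rows elsewhere.\<close>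
  define M :: "real^'n^'p" where "M = (\<chi> j k. if j \<in> S' then d (Inl j) $ k else 0)"
  have D'_mult: "(D' *v w) $ i = of_bool (i \<notin> B) * w $ i" for w i
    by (simp add: D'_def matrix_vector_mult_def if_distrib[of "\<lambda>x. x * _"] cong: if_cong)
  have M_mult: "(M *v w) $ j = (if j \<in> S' then d (Inl j) \<bullet> w else 0)" for w j
    by (simp add: M_def matrix_vector_mult_def inner_vec_def)
  \<comment> \<open>A residual on a kink would make its box constraint active with multiplier zero,
    which both alternatives exclude.\<close>
  have resid_iff: "\<bar>r z i\<bar> \<noteq> c \<and> (i \<in> B \<longleftrightarrow> \<bar>r z i\<bar> > c)"
    if "\<forall>l. l \<in> T \<longrightarrow> a z l \<noteq> 0" "\<forall>l. l \<notin> T \<longrightarrow> a z l = 0 \<and> \<bar>v l \<bullet> u z\<bar> < constraint_bound ls lam l" for z i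
  proof -
    have "a z (Inr i) = r z i - max (- c) (min (r z i) c)"
      by (simp add: a_def multiplier_def r_def psi)
    moreover have "v (Inr i) \<bullet> u z = max (- c) (min (r z i) c)"
      by (simp add: v_def u_def inner_axis' psi_vec_def psi r_def)
    moreover have "constraint_bound ls lam (Inr i :: 'p + 'n) = c"
      by (simp add: constraint_bound_def c_def)
    ultimately show ?thesis
      using that[rule_format, of "Inr i"] c by (cases "i \<in> B") (auto simp: B_def)
  qed
  have bhat: "bhat z X $ j = a z (Inl j)" for z j by (simp add: a_def multiplier_def)
  have local: "(\<forall>i. \<bar>r z i\<bar> \<noteq> c) \<and> inliers ls z X (bhat z X) = - B \<and> coord_support (bhat z X) = S' \<and>
      diag_psi' ls z X (bhat z X) = D'"
    if "\<forall>l. l \<in> T \<longrightarrow> a z l \<noteq> 0" "\<forall>l. l \<notin> T \<longrightarrow> a z l = 0 \<and> \<bar>v l \<bullet> u z\<bar> < constraint_bound ls lam l" for z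
  proof -
    have r: "\<bar>r z i\<bar> \<noteq> c" "\<bar>r z i\<bar> < c \<longleftrightarrow> i \<notin> B" for i
      using resid_iff[OF that, of i] by auto
    have p': "psi' CARD('n) ls (resid z X (bhat z X) i) = of_bool (i \<notin> B)" for i
      using psi'[of "r z i"] r[of i] by (simp add: r_def)
    have "coord_support (bhat z X) = S'"
      using that by (auto simp: coord_support_def S'_def bhat)
    then show ?thesis
      using r(1) by (simp add: inliers_def diag_psi'_def p' D'_def vec_eq_iff Compl_eq)
  qed
  have at_y: "\<forall>l. l \<in> T \<longrightarrow> a y l \<noteq> 0" "\<forall>l. l \<notin> T \<longrightarrow> a y l = 0 \<and> \<bar>v l \<bullet> u y\<bar> < constraint_bound ls lam l"
    using eventually_nhds_x_imp_x[OF loc] by auto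
  note local_y = local[OF at_y]
  have I: "I = - B" and S: "S = S'" and D: "D = D'"
    using local_y by (auto simp: I_def S_def D_def)
  have ev: "\<forall>\<^sub>F z in nhds y. inliers ls z X (bhat z X) = - B \<and> coord_support (bhat z X) = S' \<and>
      diag_psi' ls z X (bhat z X) = D'"
    using loc by eventually_elim (use local in blast)
  show "\<forall>\<^sub>F z in nhds y. inliers ls z X (bhat z X) = I" "\<forall>\<^sub>F z in nhds y. coord_support (bhat z X) = S"
    "\<forall>\<^sub>F z in nhds y. diag_psi' ls z X (bhat z X) = D"
    unfolding I S D using ev by (auto elim: eventually_mono)
  \<comment> \<open>This certifies that the diagonal of \<open>D\<close> holds genuine derivatives
    and not default values of \<open>deriv\<close>.\<close>
  show "\<forall>i. psi CARD('n) ls differentiable at (resid y X (bhat y X) i)"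
  proof
    fix i
    have "(psi CARD('n) ls has_real_derivative of_bool (\<bar>r y i\<bar> < c)) (at (r y i))"
      using has_real_derivative_psi[of "CARD('n)" ls "r y i"] ls local_y by (simp add: c_def)
    then show "psi CARD('n) ls differentiable at (resid y X (bhat y X) i)"
      unfolding r_def by (auto simp: has_field_derivative_def intro: differentiableI)
  qed
  have bhat_affine: "bhat z X = bhat y X + M *v (z - y)"
    if "\<forall>l\<in>T. a z l = a y l + d l \<bullet> (z - y)" "\<forall>l. l \<notin> T \<longrightarrow> a z l = 0" for z
    using that at_y(2) by (auto simp: vec_eq_iff M_mult bhat S'_def)
  have "\<forall>\<^sub>F z in nhds y. X *v bhat z X = X *v bhat y X + (X ** M) *v (z - y)"
    using loc
    by eventually_elim (subst bhat_affine, auto simp: matrix_vector_right_distrib matrix_vector_mul_assoc)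
  note fit = jacobian_locally_affine[OF this]
  show "(\<lambda>z. X *v bhat z X) differentiable at y" by (rule fit(1))
  have J: "J = X ** M" unfolding J_def by (rule fit(2))
  have DJ_mult: "(D' - D' ** J) *v h = D' *v (h - J *v h)" for h
    by (simp add: matrix_vector_mult_diff_rdistrib matrix_vector_mul_assoc matrix_vector_mult_diff_distrib)
  \<comment> \<open>Clipped coordinates are constant near \<open>y\<close>; at the others the score
    equals the residual, with linear part identity minus \<open>J\<close>.\<close>
  have u_affine: "\<forall>\<^sub>F z in nhds y. u z = u y + (D' - D' ** J) *v (z - y)"
    using loc
  proof eventually_elim
    case (elim z)
    have "u z $ i = (u y + (D' - D' ** J) *v (z - y)) $ i" for i
    proof (cases "i \<in> B")
      case True
      then have "v (Inr i) \<bullet> u z = v (Inr i) \<bullet> u y" using elim by (auto simp: B_def)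
      then have "u z $ i = u y $ i" by (simp add: v_def inner_axis')
      then show ?thesis using True by (simp add: DJ_mult D'_mult)
    next
      case False
      have "\<forall>l. l \<in> T \<longrightarrow> a z l \<noteq> 0" using elim by blast
      from resid_iff[OF this, of i] resid_iff[OF at_y, of i] elim False
      have "\<bar>r z i\<bar> < c" "\<bar>r y i\<bar> < c" by auto
      then have "u z $ i = r z i" "u y $ i = r y i" by (auto simp: u_def psi_vec_def psi r_def)
      moreover have "r z i = r y i + (z - y) $ i - (J *v (z - y)) $ i"
      proof -
        have "bhat z X = bhat y X + M *v (z - y)" using elim by (intro bhat_affine) auto
        moreover have "row i X \<bullet> w = (X *v w) $ i" for w
          by (simp add: matrix_vector_mul_component row_def)
        ultimately show ?thesis
          by (simp add: r_def resid_def J matrix_vector_right_distrib flip: matrix_vector_mul_assoc)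
      qed
      ultimately show ?thesis using False by (simp add: DJ_mult D'_mult)
    qed
    then show ?case by (simp add: vec_eq_iff)
  qed
  note psi_jac = jacobian_locally_affine[OF u_affine]
  show "(\<lambda>z. psi_vec ls z X (bhat z X)) differentiable at y"
    using psi_jac(1) by (simp add: u_def)
  have Jpsi: "Jpsi = D' - D' ** J" using psi_jac(2) by (simp add: u_def Jpsi_def)
  then show "Jpsi = D - D ** J" by (simp add: D)
  \<comment> \<open>The column constraints on the support stay tight on the same side, so their
    inner products with the score are constant in \<open>z\<close>.\<close>
  have orth: "column j X \<bullet> ((D' - D' ** J) *v h) = 0" if "j \<in> S'" for j h
  proof (rule inner_mult_vec_eq_0_if_eventually[of _ _ y])
    show "\<forall>\<^sub>F z in nhds y. column j X \<bullet> ((D' - D' ** J) *v (z - y)) = 0"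
      using loc u_affine
    proof eventually_elim
      case (elim z)
      have "column j X \<bullet> u z = column j X \<bullet> u y"
        using elim(1) that by (auto simp: S'_def v_def dest: bspec[of _ _ "Inl j"])
      then show ?case using elim(2) by (simp add: inner_add_right)
    qed
  qed
  have J_mult: "J *v h = (\<Sum>j\<in>S'. (d (Inl j) \<bullet> h) *\<^sub>R column j X)" for h
  proof -
    have "J *v h = X *v (M *v h)" by (simp add: J matrix_vector_mul_assoc)
    also have "\<dots> = (\<Sum>j\<in>UNIV. (M *v h) $ j *s column j X)" by (rule matrix_mult_sum)
    also have "\<dots> = (\<Sum>j\<in>S'. (d (Inl j) \<bullet> h) *\<^sub>R column j X)"
      by (intro sum.mono_neutral_cong_right) (auto simp: M_mult scalar_mult_eq_scaleR)
    finally show ?thesis .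
  qed
  show "is_orthogonal_projection (D ** J) (col_span_on D X S)"
    unfolding col_span_on_def S D
  proof (rule orthogonal_projection_if_biorthogonal)
    fix h
    have "(D' ** J) *v h = (\<Sum>j\<in>S'. (d (Inl j) \<bullet> h) *\<^sub>R (D' *v column j X))"
      by (simp add: J_mult linear_sum[OF matrix_vector_mul_linear] matrix_vector_mult_scaleR
          flip: matrix_vector_mul_assoc)
    then show "(D' ** J) *v h \<in> span ((\<lambda>j. D' *v column j X) ` S')"
      by (simp add: span_sum span_scale span_base)
  next
    fix h j assume j: "j \<in> S'"
    \<comment> \<open>\<open>D'\<close> is diagonal with entries 0 and 1, hence symmetric and
      idempotent, and can be moved to the other factor.\<close>
    have "(h - (D' ** J) *v h) \<bullet> (D' *v column j X) = column j X \<bullet> ((D' - D' ** J) *v h)"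
      by (auto simp: inner_vec_def DJ_mult D'_mult simp flip: matrix_vector_mul_assoc intro!: sum.cong)
    then show "(h - (D' ** J) *v h) \<bullet> (D' *v column j X) = 0" using orth[OF j] by simp
  qed
  have J_comp: "J $ i $ i = (\<Sum>j\<in>S'. d (Inl j) $ i * X $ i $ j)" for i
  proof -
    have "J $ i $ i = (J *v axis i 1) $ i" by (simp add: matrix_vector_mult_basis column_def)
    then show ?thesis by (simp add: J_mult inner_axis column_def)
  qed
  \<comment> \<open>Biorthogonality to the active coordinate vector of \<open>i\<close>; multiplying
    \<open>J\<close> by \<open>D'\<close> thus removes nothing from its trace.\<close>
  have J_zero: "J $ i $ i = 0" if "i \<in> B" for i
  proof -
    have "d (Inl j) $ i = 0" if "j \<in> S'" for j
      using dual[of "Inl j" "Inr i"] that \<open>i \<in> B\<close> by (simp add: S'_def B_def v_def inner_axis)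
    then show ?thesis by (simp add: J_comp)
  qed
  have DJ_comp: "(D' ** J) $ i $ i = of_bool (i \<notin> B) * J $ i $ i" for i
    by (simp add: D'_def matrix_matrix_mult_def if_distrib[of "\<lambda>x. x * _"] cong: if_cong)
  have tr1: "trace J = trace (D' ** J)"
    unfolding trace_def by (intro sum.cong) (auto simp: DJ_comp J_zero)
  then show "trace J = trace (D ** J)" by (simp add: D)
  have "trace J = (\<Sum>i\<in>UNIV. \<Sum>j\<in>S'. d (Inl j) $ i * X $ i $ j)"
    by (simp add: trace_def J_comp)
  also have "\<dots> = (\<Sum>j\<in>S'. \<Sum>i\<in>UNIV. d (Inl j) $ i * X $ i $ j)" by (rule sum.swap)
  also have "\<dots> = (\<Sum>j\<in>S'. d (Inl j) \<bullet> v (Inl j))"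
    by (simp add: inner_vec_def v_def column_def)
  also have "\<dots> = real (card S')" by (simp add: dual S'_def)
  finally have tr2: "trace (D' ** J) = real (card S')" by (simp add: tr1)
  then show "trace (D ** J) = real (card S)" by (simp add: D S)
  have "trace D' = real (card (- B))"
    by (simp add: trace_def D'_def Compl_eq del: of_bool_not_iff)
  then show "trace Jpsi = real (card I) - real (card S)"
    by (simp add: Jpsi trace_sub tr2 I S)
  \<comment> \<open>The active constraints are the support columns and the clipped observations. At
    most \<open>CARD('n)\<close> normals are independent, which leaves at least as many inliers as
    support columns.\<close>
  have "T = S' <+> B"
  proof (rule set_eqI)
    fix l show "l \<in> T \<longleftrightarrow> l \<in> S' <+> B" by (cases l) (auto simp: S'_def B_def)
  qed
  then have "card T = card S' + card B" by (simp add: card_Plus)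
  moreover have "card T \<le> CARD('n)" using card_le_DIM_if_dual_family[OF _ dual] by simp
  moreover have "card (- B) = CARD('n) - card B"
    by (simp add: Compl_eq_Diff_UNIV card_Diff_subset)
  ultimately have "card S' \<le> card (- B)" by simp
  then show "real (card I) - real (card S) \<ge> 0" by (simp add: I S)
qed

theorem proposition2p4:
  fixes ls lam :: real
    and bhat :: "real^'n \<Rightarrow> real^'p^'n \<Rightarrow> real^'p"
  assumes "ls > 0" and "lam > 0"
    and "\<And>y X. is_arg_min (huber_lasso_objective ls lam y X) (\<lambda>_. True) (bhat y X)"
  shows "AE (y, X) in lborel.
    (let I = inliers ls y X (bhat y X);
         S = coord_support (bhat y X);
         D = diag_psi' ls y X (bhat y X);
         J = jacobian (\<lambda>z. X *v bhat z X) (at y);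
         Jpsi = jacobian (\<lambda>z. psi_vec ls z X (bhat z X)) (at y);
         Q = D ** J
     in (\<forall>i. psi CARD('n) ls differentiable at (resid y X (bhat y X) i)) \<and>
        (\<forall>\<^sub>F z in nhds y. inliers ls z X (bhat z X) = I) \<and>
        (\<forall>\<^sub>F z in nhds y. coord_support (bhat z X) = S) \<and>
        (\<forall>\<^sub>F z in nhds y. diag_psi' ls z X (bhat z X) = D) \<and>
        (\<lambda>z. X *v bhat z X) differentiable at y \<and>
        is_orthogonal_projection Q (col_span_on D X S) \<and>
        (\<lambda>z. psi_vec ls z X (bhat z X)) differentiable at y \<and>
        Jpsi = D - Q \<and>
        trace J = trace Q \<and>
        trace Q = real (card S) \<and>
        trace Jpsi = real (card I) - real (card S) \<and>
        real (card I) - real (card S) \<ge> 0)"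
  using AE_nondegenerate[OF assms(1,2)]
proof eventually_elim
  case (elim p)
  obtain y X where p: "p = (y, X)" by (cases p)
  define T where "T = {l. \<bar>constraint_vec X l \<bullet> psi_vec ls y X (bhat y X)\<bar> = constraint_bound ls lam l}"
  note nondeg = elim[unfolded p fst_conv snd_conv, rule_format, OF minimizer_kkt[OF assms] T_def]
  note concl = nondegenerate_conclusion[OF assms T_def nondeg[THEN conjunct1] nondeg[THEN conjunct2]]
  show ?case
    unfolding p case_prod_conv Let_def
    by (intro conjI concl)
qed

end
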